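(* Let $M$ be a checking stack automaton (CSA). For each $z\in\{{\rm a},{\rm s}\}$, exactly one of the following must occur: 1. $M$ is $z$-unlimited; 2. $M$ is $z$-limited and $\sigma^z_M(n)\in O(1)$; 3. $M$ is $z$-limited, $\sigma^z_M(n)\in O(n)$, $\sigma^z_M(n)\notin o(n)$, and $\overline{\sigma}^z_M(n)\in\Theta(n)$. Furthermore, it is decidable, given $M$, which of these three cases occurs.
   Context: **Stack automata.** A one-way nondeterministic stack automaton (SA) is a 6-tuple $M=(Q,\Sigma,\Gamma,\delta,q_0,F)$: $Q$ is a finite set of states; $\Sigma,\Gamma$ are the (finite) input and stack alphabets; $\Gamma$ contains two special symbols $\triangleright$ (bottom marker) and $\triangleleft$ (top marker), and $\Gamma_0=\Gamma\setminus\{\triangleright,\triangleleft\}$; $q_0\in Q$ is the initial state; $F\subseteq Q$ is the set of final states; $\delta$ is a nondeterministic transition function from $Q\times(\Sigma\cup\{\lambda\})\times\Gamma$ into subsets of $Q\times\{\mathtt{stay},\mathtt{push}(x),\mathtt{pop},-1,0,+1 \mid x\in\Gamma_0\}$ ($\lambda$ is the empty word). Write $(q,a,y)\to(p,\iota)$ for $(p,\iota)\in\delta(q,a,y)$. A configuration is a triple $c=(q,w,\gamma)$ with $q\in Q$ the current state, $w\in\Sigma^*$ the remaining input, and $\gamma\in \triangleright\Gamma_0^*\uparrow\Gamma_0^*\triangleleft$ or $\gamma\in\triangleright\Gamma_0^*\triangleleft\uparrow$, where $\uparrow\notin\Gamma$ marks the stack head, which scans the symbol directly preceding it. The stack size of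 $c$ is $\|c\|_\Gamma=|\gamma|-3$ (number of symbols of $\Gamma_0$ on the stack). Write relation $\vdash_w$: if $(q,a,x)\to(p,\iota)$ with $x\in\Gamma_0\cup\{\triangleright\}$, $a\in\Sigma\cup\{\lambda\}$, then for $u\in\Sigma^*$ and $\gamma x\triangleleft\in\triangleright\Gamma_0^*\triangleleft$: $(q,au,\gamma x\uparrow\triangleleft)\vdash_w(p,u,\gamma x\uparrow\triangleleft)$ if $\iota=\mathtt{stay}$; $(q,au,\gamma x\uparrow\triangleleft)\vdash_w(p,u,\gamma xy\uparrow\triangleleft)$ if $\iota=\mathtt{push}(y)$; $(q,au,\gamma x\uparrow\triangleleft)\vdash_w(p,u,\gamma\uparrow\triangleleft)$ if $\iota=\mathtt{pop}$ and $x\ne\triangleright$. (These moves are undefined if the head is not at the topmost stack symbol.) Read relation $\vdash_r$: if $(q,a,x)\to(p,\iota)$ with $x\in\Gamma$, then for $u\in\Sigma^*$ and $\gamma_1x\gamma_2\in\triangleright\Gamma_0^*\triangleleft$: $(q,au,\gamma_1x\uparrow\gamma_2)\vdash_r(p,u,\gamma_1\uparrow x\gamma_2)$ if $\iota=-1$ and $x\neq\triangleright$; $(q,au,\gamma_1x\uparrow\gamma_2)\vdash_r(p,u,\gamma_1x\uparrow\gamma_2)$ if $\iota=0$; $(q,au,\gamma_1x\uparrow\gamma_2)\vdash_r(p,u,\gamma_1xy\uparrow\gamma_2')$ if $\iota=+1$ and $\gamma_2=y\gamma_2'$, $y\in\Gamma$. Let $\vdash=\vdash_w\cup\vdash_r$.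 A partial computation on $u\in\Sigma^*$ is a finite sequence of configurations $c_0\vdash\cdots\vdash c_m$ with $c_0=(q_0,u,\triangleright\uparrow\triangleleft)$. It is a computation if the remaining input in $c_m$ is $\lambda$, and an accepting computation if moreover the state of $c_m$ is in $F$. Its stack size is $\|\mathcal C\|_\Gamma=\max_j\|c_j\|_\Gamma$. The accepted language $L(M)$ is the set of words on which $M$ has an accepting computation. An SA has partitioned states if $Q$ is a disjoint union $Q_w\cup Q_r$ (write states and read states), $F\subseteq Q_r$, all transitions from states in $Q_w$ have $\iota\in\{\mathtt{stay},\mathtt{push}(x),\mathtt{pop}\}$ and all transitions from states in $Q_r$ have $\iota\in\{-1,0,+1\}$. An SA is non-erasing (NESA) if it has no $\mathtt{pop}$ transitions. A checking stack automaton (CSA) is a NESA with partitioned states and with no transitions from a read state to a write state. **Accept and strong space measures.** For $u\in\Sigma^*$: $\sigma^{\rm a}_M(u)$ is the maximum of $\|\mathcal C\|_\Gamma$ over accepting computations $\mathcal C$ of $M$ on $u$ if $u\in L(M)$ and this maximum exists, $\infty$ if $u\in L(M)$ and $M$ has accepting computations on $u$ of arbitrarily large stack size, and $0$ if $u\notin L(M)$. $\sigma^{\rm s}_M(u)$ is the maximum of $\|\mathcal C\|_\Gamma$ over all partial computations $\mathcal C$ of $M$ on $u$ if it exists, and $\infty$ otherwise. For $z\in\{{\rm a},{\rm s}\}$, $\sigma^z_M(n)=\max\{\sigma^z_M(u)\mid u\in\Sigma^*,|u|=n\}$ and $\overline{\sigma}^z_M(n)=\max\{\sigma^z_M(u)\mid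 u\in\Sigma^*,|u|\le n\}$. $M$ is $z$-unlimited if $\sigma^z_M(u)=\infty$ for some word $u$, and $z$-limited otherwise. $f\in o(g)$ means: for all $c>0$ there is $n_0$ such that $f(n)<c\,g(n)$ for all $n>n_0$. The input to the decision problem is a (finite) description of $M$. *)

theory Defs
  imports
    "HOL-Library.Landau_Symbols"
    "HOL-Library.Extended_Nat"
    "HOL-Library.Nat_Bijection"
begin

section \<open>Stack automata\<close>

datatype 'g stack_sym = Bottom | Top | Sym 'g

text \<open>\<open>Down\<close>, \<open>Here\<close>, \<open>Up\<close> are the head moves $-1$, $0$, $+1$ of the read mode.\<close>

datatype 'g instr = Stay | Push 'g | Pop | Down | Here | Up

text \<open>
  The field \<open>work\<close> is $\Gamma_0$, the stack alphabet without the two markers.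
  In \<open>delta\<close>, the input argument \<open>None\<close> stands for the empty word.
\<close>

record ('q, 'a, 'g) sa =
  states :: "'q set"
  inputs :: "'a set"
  work :: "'g set"
  delta :: "'q \<Rightarrow> 'a option \<Rightarrow> 'g stack_sym \<Rightarrow> ('q \<times> 'g instr) set"
  start :: 'q
  final :: "'q set"

definition stack_alphabet :: "('q, 'a, 'g) sa \<Rightarrow> 'g stack_sym set" where
  "stack_alphabet M = {Bottom, Top} \<union> Sym ` work M"

definition input_labels :: "('q, 'a, 'g) sa \<Rightarrow> 'a option set" where
  "input_labels M = insert None (Some ` inputs M)"

definition instrs :: "('q, 'a, 'g) sa \<Rightarrow> 'g instr set" where
  "instrs M = {Stay, Pop, Down, Here, Up} \<union> Push ` work M"

definition stack_automaton :: "('q, 'a, 'g) sa \<Rightarrow> bool" where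
  "stack_automaton M \<longleftrightarrow>
     finite (states M) \<and> finite (inputs M) \<and> finite (work M) \<and>
     start M \<in> states M \<and> final M \<subseteq> states M \<and>
     (\<forall>q \<in> states M. \<forall>a \<in> input_labels M. \<forall>x \<in> stack_alphabet M.
        delta M q a x \<subseteq> states M \<times> instrs M)"

text \<open>Values of \<open>delta\<close> outside its intended domain are ignored.\<close>

definition trans_rel ::
  "('q, 'a, 'g) sa \<Rightarrow> ('q \<times> 'a option \<times> 'g stack_sym \<times> 'q \<times> 'g instr) set" where
  "trans_rel M = {(q, a, x, p, i). q \<in> states M \<and> a \<in> input_labels M \<and>
     x \<in> stack_alphabet M \<and> (p, i) \<in> delta M q a x}"

text \<open>
  A configuration \<open>(q, w, l, r)\<close> has the stack \<open>l @ r\<close> and the head marker between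
  \<open>l\<close> and \<open>r\<close>, so the scanned symbol is \<open>last l\<close>.
\<close>

type_synonym ('q, 'a, 'g) config =
  "'q \<times> 'a list \<times> 'g stack_sym list \<times> 'g stack_sym list"

definition stacks :: "('q, 'a, 'g) sa \<Rightarrow> 'g stack_sym list set" where
  "stacks M = {Bottom # map Sym v @ [Top] | v. v \<in> lists (work M)}"

fun stack_size :: "('q, 'a, 'g) config \<Rightarrow> nat" where
  "stack_size (q, w, l, r) = length l + length r - 2"

fun label_word :: "'a option \<Rightarrow> 'a list" where
  "label_word None = []"
| "label_word (Some a) = [a]"

inductive write_step ::
  "('q, 'a, 'g) sa \<Rightarrow> ('q, 'a, 'g) config \<Rightarrow> ('q, 'a, 'g) config \<Rightarrow> bool"
  for M where
  stay: "\<lbrakk>(q, a, x, p, Stay) \<in> trans_rel M; u \<in> lists (inputs M); g @ [x, Top] \<in> stacks M\<rbrakk>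
    \<Longrightarrow> write_step M (q, label_word a @ u, g @ [x], [Top]) (p, u, g @ [x], [Top])"
| push: "\<lbrakk>(q, a, x, p, Push y) \<in> trans_rel M; u \<in> lists (inputs M); g @ [x, Top] \<in> stacks M\<rbrakk>
    \<Longrightarrow> write_step M (q, label_word a @ u, g @ [x], [Top]) (p, u, g @ [x, Sym y], [Top])"
| pop: "\<lbrakk>(q, a, x, p, Pop) \<in> trans_rel M; u \<in> lists (inputs M); g @ [x, Top] \<in> stacks M;
      x \<noteq> Bottom\<rbrakk>
    \<Longrightarrow> write_step M (q, label_word a @ u, g @ [x], [Top]) (p, u, g, [Top])"

inductive read_step ::
  "('q, 'a, 'g) sa \<Rightarrow> ('q, 'a, 'g) config \<Rightarrow> ('q, 'a, 'g) config \<Rightarrow> bool"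
  for M where
  down: "\<lbrakk>(q, a, x, p, Down) \<in> trans_rel M; u \<in> lists (inputs M); l @ x # r \<in> stacks M;
      x \<noteq> Bottom\<rbrakk>
    \<Longrightarrow> read_step M (q, label_word a @ u, l @ [x], r) (p, u, l, x # r)"
| here: "\<lbrakk>(q, a, x, p, Here) \<in> trans_rel M; u \<in> lists (inputs M); l @ x # r \<in> stacks M\<rbrakk>
    \<Longrightarrow> read_step M (q, label_word a @ u, l @ [x], r) (p, u, l @ [x], r)"
| up: "\<lbrakk>(q, a, x, p, Up) \<in> trans_rel M; u \<in> lists (inputs M); l @ x # y # r \<in> stacks M\<rbrakk>
    \<Longrightarrow> read_step M (q, label_word a @ u, l @ [x], y # r) (p, u, l @ [x, y], r)"

definition step ::
  "('q, 'a, 'g) sa \<Rightarrow> ('q, 'a, 'g) config \<Rightarrow> ('q, 'a, 'g) config \<Rightarrow> bool" where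
  "step M c d \<longleftrightarrow> write_step M c d \<or> read_step M c d"

definition partial_computation ::
  "('q, 'a, 'g) sa \<Rightarrow> 'a list \<Rightarrow> ('q, 'a, 'g) config list \<Rightarrow> bool" where
  "partial_computation M u cs \<longleftrightarrow>
     cs \<noteq> [] \<and> hd cs = (start M, u, [Bottom], [Top]) \<and> successively (step M) cs"

definition computation ::
  "('q, 'a, 'g) sa \<Rightarrow> 'a list \<Rightarrow> ('q, 'a, 'g) config list \<Rightarrow> bool" where
  "computation M u cs \<longleftrightarrow> partial_computation M u cs \<and> fst (snd (last cs)) = []"

definition accepting_computation ::
  "('q, 'a, 'g) sa \<Rightarrow> 'a list \<Rightarrow> ('q, 'a, 'g) config list \<Rightarrow> bool" where
  "accepting_computation M u cs \<longleftrightarrow> computation M u cs \<and> fst (last cs) \<in> final M"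

definition computation_size :: "('q, 'a, 'g) config list \<Rightarrow> nat" where
  "computation_size cs = Max (stack_size ` set cs)"

definition language :: "('q, 'a, 'g) sa \<Rightarrow> 'a list set" where
  "language M = {u \<in> lists (inputs M). \<exists>cs. accepting_computation M u cs}"

definition partitioned_states :: "('q, 'a, 'g) sa \<Rightarrow> 'q set \<Rightarrow> 'q set \<Rightarrow> bool" where
  "partitioned_states M Qw Qr \<longleftrightarrow>
     states M = Qw \<union> Qr \<and> Qw \<inter> Qr = {} \<and> final M \<subseteq> Qr \<and>
     (\<forall>(q, a, x, p, i) \<in> trans_rel M.
        (q \<in> Qw \<longrightarrow> i \<in> {Stay, Pop} \<union> range Push) \<and> (q \<in> Qr \<longrightarrow> i \<in> {Down, Here, Up}))"

definition non_erasing :: "('q, 'a, 'g) sa \<Rightarrow> bool" where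
  "non_erasing M \<longleftrightarrow> (\<forall>(q, a, x, p, i) \<in> trans_rel M. i \<noteq> Pop)"

definition checking_stack_automaton :: "('q, 'a, 'g) sa \<Rightarrow> bool" where
  "checking_stack_automaton M \<longleftrightarrow>
     stack_automaton M \<and> non_erasing M \<and>
     (\<exists>Qw Qr. partitioned_states M Qw Qr \<and>
        (\<forall>(q, a, x, p, i) \<in> trans_rel M. \<not> (q \<in> Qr \<and> p \<in> Qw)))"


section \<open>Space measures\<close>

datatype space_kind = Accept | Strong

text \<open>
  On \<^typ>\<open>enat\<close>, the supremum of a nonempty set is its maximum if the set is bounded, and
  \<open>\<infinity>\<close> otherwise; the supremum of the empty set is \<open>0\<close>.  The latter only matters when
  the input alphabet is empty, for word lengths \<open>n > 0\<close>.
\<close>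

fun word_space :: "space_kind \<Rightarrow> ('q, 'a, 'g) sa \<Rightarrow> 'a list \<Rightarrow> enat" where
  "word_space Accept M u =
     (if u \<in> language M
      then (SUP cs \<in> {cs. accepting_computation M u cs}. enat (computation_size cs)) else 0)"
| "word_space Strong M u =
     (SUP cs \<in> {cs. partial_computation M u cs}. enat (computation_size cs))"

definition space :: "space_kind \<Rightarrow> ('q, 'a, 'g) sa \<Rightarrow> nat \<Rightarrow> enat" where
  "space z M n = (SUP u \<in> {u \<in> lists (inputs M). length u = n}. word_space z M u)"

definition space_upto :: "space_kind \<Rightarrow> ('q, 'a, 'g) sa \<Rightarrow> nat \<Rightarrow> enat" where
  "space_upto z M n = (SUP u \<in> {u \<in> lists (inputs M). length u \<le> n}. word_space z M u)"

definition unlimited :: "space_kind \<Rightarrow> ('q, 'a, 'g) sa \<Rightarrow> bool" where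
  "unlimited z M \<longleftrightarrow> (\<exists>u \<in> lists (inputs M). word_space z M u = \<infinity>)"

abbreviation limited :: "space_kind \<Rightarrow> ('q, 'a, 'g) sa \<Rightarrow> bool" where
  "limited z M \<equiv> \<not> unlimited z M"

text \<open>Meaningful for finite values only, which is the case for limited automata.\<close>

abbreviation real_of_enat :: "enat \<Rightarrow> real" where
  "real_of_enat x \<equiv> real (the_enat x)"

definition constant_space :: "space_kind \<Rightarrow> ('q, 'a, 'g) sa \<Rightarrow> bool" where
  "constant_space z M \<longleftrightarrow>
     limited z M \<and> (\<lambda>n. real_of_enat (space z M n)) \<in> O(\<lambda>n. 1)"

definition linear_space :: "space_kind \<Rightarrow> ('q, 'a, 'g) sa \<Rightarrow> bool" where
  "linear_space z M \<longleftrightarrow>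
     limited z M \<and>
     (\<lambda>n. real_of_enat (space z M n)) \<in> O(\<lambda>n. real n) \<and>
     (\<lambda>n. real_of_enat (space z M n)) \<notin> o(\<lambda>n. real n) \<and>
     (\<lambda>n. real_of_enat (space_upto z M n)) \<in> \<Theta>(\<lambda>n. real n)"

text \<open>The library's little-o agrees with the variant that uses a strict inequality.\<close>

lemma smallo_real_iff_strict:
  fixes f :: "nat \<Rightarrow> nat"
  shows "(\<lambda>n. real (f n)) \<in> o(\<lambda>n. real n) \<longleftrightarrow>
    (\<forall>c>0. \<exists>n0. \<forall>n>n0. real (f n) < c * real n)"
proof
  assume o: "(\<lambda>n. real (f n)) \<in> o(\<lambda>n. real n)"
  show "\<forall>c>0. \<exists>n0. \<forall>n>n0. real (f n) < c * real n"
  proof (intro allI impI)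
    fix c :: real assume c: "c > 0"
    then have "eventually (\<lambda>n. norm (real (f n)) \<le> c / 2 * norm (real n)) at_top"
      using landau_o.smallD[OF o, of "c / 2"] by simp
    then obtain N where N: "\<forall>n\<ge>N. real (f n) \<le> c / 2 * real n"
      by (auto simp: eventually_at_top_linorder)
    have "real (f n) < c * real n" if "n > N" for n
    proof -
      have "real (f n) \<le> c / 2 * real n" using N that by simp
      also have "\<dots> < c * real n" using c that by simp
      finally show ?thesis .
    qed
    then show "\<exists>n0. \<forall>n>n0. real (f n) < c * real n" by blast
  qed
next
  assume s: "\<forall>c>0. \<exists>n0. \<forall>n>n0. real (f n) < c * real n"
  show "(\<lambda>n. real (f n)) \<in> o(\<lambda>n. real n)"
  proof (rule landau_o.smallI)
    fix c :: real assume "c > 0"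
    then obtain n0 where "\<forall>n>n0. real (f n) < c * real n" using s by blast
    then show "eventually (\<lambda>n. norm (real (f n)) \<le> c * norm (real n)) at_top"
      unfolding eventually_at_top_dense by (intro exI[of _ n0]) (auto intro: less_imp_le)
  qed
qed


section \<open>Computable functions\<close>

text \<open>
  The total \<open>\<mu>\<close>-recursive functions: \<open>recursive k f\<close> says that \<open>f\<close>, restricted to
  argument lists of length \<open>k\<close>, is a \<open>k\<close>-ary recursive function.  Values on lists of other
  lengths are irrelevant.  Minimisation is only applied to regular functions, so that
  all functions stay total.
\<close>

inductive recursive :: "nat \<Rightarrow> (nat list \<Rightarrow> nat) \<Rightarrow> bool" where
  zero: "recursive k (\<lambda>xs. 0)"
| succ: "recursive 1 (\<lambda>xs. Suc (hd xs))"
| proj: "i < k \<Longrightarrow> recursive k (\<lambda>xs. xs ! i)"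
| comp: "\<lbrakk>recursive (length fs) g; \<forall>f \<in> set fs. recursive k f\<rbrakk>
    \<Longrightarrow> recursive k (\<lambda>xs. g (map (\<lambda>f. f xs) fs))"
| prec: "\<lbrakk>recursive k g; recursive (Suc (Suc k)) h\<rbrakk>
    \<Longrightarrow> recursive (Suc k)
          (\<lambda>xs. rec_nat (g (tl xs)) (\<lambda>n r. h (n # r # tl xs)) (hd xs))"
| minim: "\<lbrakk>recursive (Suc k) g; \<forall>xs. length xs = k \<longrightarrow> (\<exists>y. g (y # xs) = 0)\<rbrakk>
    \<Longrightarrow> recursive k (\<lambda>xs. LEAST y. g (y # xs) = 0)"

definition computable :: "(nat \<Rightarrow> nat) \<Rightarrow> bool" where
  "computable f \<longleftrightarrow> (\<exists>g. recursive 1 g \<and> (\<forall>n. g [n] = f n))"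


section \<open>Finite descriptions of stack automata\<close>

text \<open>
  Automata that serve as inputs of algorithms have natural numbers as names of states and
  symbols.  The six finite components are coded as numbers; \<^const>\<open>set_encode\<close> is a
  bijection between finite sets of natural numbers and natural numbers.
\<close>

fun label_code :: "nat option \<Rightarrow> nat" where
  "label_code None = 0"
| "label_code (Some a) = Suc a"

fun stack_sym_code :: "nat stack_sym \<Rightarrow> nat" where
  "stack_sym_code Bottom = 0"
| "stack_sym_code Top = 1"
| "stack_sym_code (Sym x) = x + 2"

fun instr_code :: "nat instr \<Rightarrow> nat" where
  "instr_code Stay = 0"
| "instr_code Pop = 1"
| "instr_code Down = 2"
| "instr_code Here = 3"
| "instr_code Up = 4"
| "instr_code (Push x) = x + 5"

fun trans_code :: "nat \<times> nat option \<times> nat stack_sym \<times> nat \<times> nat instr \<Rightarrow> nat" where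
  "trans_code (q, a, x, p, i) =
     list_encode [q, label_code a, stack_sym_code x, p, instr_code i]"

definition sa_code :: "(nat, nat, nat) sa \<Rightarrow> nat" where
  "sa_code M = list_encode
     [set_encode (states M), set_encode (inputs M), set_encode (work M),
      set_encode (trans_code ` trans_rel M), start M, set_encode (final M)]"

end

theory Submission imports Defs begin

text \<open>
  A run of a checking stack automaton writes a word and then scans it two-way, so it is a walk
  in a finite graph whose nodes are a phase, a state and a head position on the written word.
  Mark each stack symbol as quiet or loud, where no input may be read while the head is on a quiet
  symbol. The marked words that admit a successful walk form a regular language with \<open>K\<close> classes,
  \<open>K\<close> explicit in the size of the automaton, by comparing crossing behaviours of prefixes. A walk
  without repeated nodes reads at most a constant number of letters per loud symbol, and a
  computation on \<open>u\<close> needs at most \<open>|u|\<close> loud symbols. Hence pumping shows: the automaton is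
  unlimited iff some successful word has \<open>K\<close> consecutive quiet symbols (pump them; only finitely
  many inputs are short); otherwise stack sizes are at most \<open>K (|u| + 1)\<close>, and they are unbounded
  iff some successful word has length at least \<open>K\<close>, in which case the lengths of successful words
  have gaps at most \<open>K\<close> and each is attained on an input of linear length. Pumping down bounds the
  length of witnesses for both conditions, so they can be decided by bounded search.
\<close>

section \<open>Pumping for walks on a marked stack\<close>

text \<open>Input words do not occur in walks. The three cases only ask which stack sizes occur for
  inputs of which lengths, so an edge may carry any label and an input is read off the walk
  afterwards. This is why loops can be cut out: no input is prescribed, and a shorter one only
  strengthens a lower bound on space. The obstacle is that input may be read in both phases and at
  many visits to one cell, so the written word alone does not determine the input length; the
  marking makes the relevant part of it visible on the word. Flags only forbid edges, so a walk
  survives when cells become loud, and the marking can be built along a computation whose pushed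
  cells all start quiet. The strong measure is treated like the other one: all states become
  targets, and \<open>switch\<close> turns a configuration of the write phase into a scanning one
  with the same stack. \<open>K\<close> counts pairs of a last cell and a crossing relation in terms
  of an upper bound for the numbers of states and symbols. The code of the automaton is such a
  bound, so \<open>K\<close> can be computed from it directly.\<close>

type_synonym 'q node = "bool \<times> 'q \<times> nat"

text \<open>
  The first node component tells whether the automaton reads. Writing is simulated on the final
  stack content: a push is a move onto a symbol that is already there, and \<open>switch\<close> requires that
  everything has been written, so that states need not be partitioned. The flag of a stack symbol
  forbids reading input while it is scanned.
\<close>

inductive gedge ::
  "('q, 'a, 'g) sa \<Rightarrow> ('g stack_sym \<times> bool) list \<Rightarrow> 'a option \<Rightarrow> 'q node \<Rightarrow> 'q node \<Rightarrow> bool"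
  for M t where
  stay: "\<lbrakk>i < length t; (q, a, fst (t ! i), p, Stay) \<in> trans_rel M; snd (t ! i) \<longrightarrow> a = None\<rbrakk>
    \<Longrightarrow> gedge M t a (False, q, i) (False, p, i)"
| push: "\<lbrakk>Suc i < length t; (q, a, fst (t ! i), p, Push y) \<in> trans_rel M;
      snd (t ! i) \<longrightarrow> a = None; fst (t ! Suc i) = Sym y\<rbrakk>
    \<Longrightarrow> gedge M t a (False, q, i) (False, p, Suc i)"
| switch: "\<lbrakk>Suc i < length t; fst (t ! Suc i) = Top; q \<in> states M\<rbrakk>
    \<Longrightarrow> gedge M t None (False, q, i) (True, q, i)"
| down: "\<lbrakk>Suc i < length t; (q, a, fst (t ! Suc i), p, Down) \<in> trans_rel M;
      snd (t ! Suc i) \<longrightarrow> a = None\<rbrakk>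
    \<Longrightarrow> gedge M t a (True, q, Suc i) (True, p, i)"
| here: "\<lbrakk>i < length t; (q, a, fst (t ! i), p, Here) \<in> trans_rel M; snd (t ! i) \<longrightarrow> a = None\<rbrakk>
    \<Longrightarrow> gedge M t a (True, q, i) (True, p, i)"
| up: "\<lbrakk>Suc i < length t; (q, a, fst (t ! i), p, Up) \<in> trans_rel M; snd (t ! i) \<longrightarrow> a = None\<rbrakk>
    \<Longrightarrow> gedge M t a (True, q, i) (True, p, Suc i)"

abbreviation reach where
  "reach M t \<equiv> (\<lambda>c d. \<exists>a. gedge M t a c d)\<^sup>*\<^sup>*"

section \<open>Locality of edges\<close>

lemma gedge_append: "gedge M t a c d \<Longrightarrow> gedge M (t @ t') a c d"
  by (erule gedge.cases) (auto intro!: gedge.intros simp: nth_append)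

lemma gedge_prepend:
  assumes "gedge M t a (h, q, i) (h', p, j)"
  shows "gedge M (s @ t) a (h, q, length s + i) (h', p, length s + j)"
proof -
  have n: "(s @ t) ! Suc (length s + k) = t ! Suc k" for k
    by (metis add_Suc_right nth_append_length_plus)
  show ?thesis using assms by cases (auto intro!: gedge.intros simp: n)
qed

lemma gedge_bounded:
  "gedge M t a (h, q, i) (h', p, j) \<Longrightarrow> i < length t \<and> j < length t"
  by (erule gedge.cases) auto

text \<open>An edge moves the head by at most one cell, so it stays on one side of \<open>x\<close>,
  a cell that belongs to both sides. The distinction on \<open>h' = h\<close> is due to
  \<open>switch\<close>: at \<open>x\<close> it inspects the next cell, which lies in
  \<open>z\<close>.\<close>

lemma gedge_split:
  assumes "gedge M (s @ x # z) a (h, q, i) (h', p, j)"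
  shows "gedge M (s @ [x]) a (h, q, i) (h', p, j) \<or>
    (\<exists>i' j'. i = length s + i' \<and> j = length s + j' \<and> gedge M (x # z) a (h, q, i') (h', p, j'))"
proof (cases "max i j \<le> length s \<and> (h' = h)")
  case True
  have n: "(s @ x # z) ! k = (s @ [x]) ! k" if "k \<le> length s" for k
    using that by (auto simp: nth_append)
  from assms True have "gedge M (s @ [x]) a (h, q, i) (h', p, j)"
    by cases (auto intro!: gedge.intros simp: n)
  then show ?thesis ..
next
  case False
  have n: "(s @ x # z) ! (length s + k) = (x # z) ! k" for k by (simp add: nth_append)
  show ?thesis
  proof (cases "Suc i \<le> length s")
    case True
    have n: "(s @ x # z) ! k = (s @ [x]) ! k" if "k \<le> length s" for k
      using that by (auto simp: nth_append)
    from assms True False have "gedge M (s @ [x]) a (h, q, i) (h', p, j)"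
      by cases (auto intro!: gedge.intros simp: n)
    then show ?thesis ..
  next
    case ni: False
    have "length s \<le> j" using assms False ni by cases auto
    with ni obtain i' j' where ij: "i = length s + i'" "j = length s + j'"
      by (metis le_Suc_ex not_less_eq_eq)
    have m: "(s @ x # z) ! Suc (length s + k) = z ! k" for k by (simp add: nth_append)
    from assms ij have "gedge M (x # z) a (h, q, i') (h', p, j')"
      by cases (auto intro!: gedge.intros simp: n m)
    with ij show ?thesis by blast
  qed
qed

lemma trans_rel_wf:
  assumes "stack_automaton M" "(q, a, x, p, i) \<in> trans_rel M"
  shows "q \<in> states M \<and> a \<in> input_labels M \<and> p \<in> states M \<and> i \<in> instrs M"
  using assms unfolding trans_rel_def stack_automaton_def by fast

lemma gedge_state:
  "stack_automaton M \<Longrightarrow> gedge M t a c (h, p, j) \<Longrightarrow> p \<in> states M"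
  by (erule gedge.cases) (auto dest: trans_rel_wf)

lemma reach_append: "reach M t c d \<Longrightarrow> reach M (t @ t') c d"
  by (erule rtranclp_mono[THEN predicate2D, rotated]) (auto intro: gedge_append)

definition accepts_tape ::
  "('q, 'a, 'g) sa \<Rightarrow> 'q set \<Rightarrow> ('g stack_sym \<times> bool) list \<Rightarrow> bool" where
  "accepts_tape M F t \<longleftrightarrow> (\<exists>q\<in>F. \<exists>i. reach M t (False, start M, 0) (True, q, i))"

text \<open>
  A walk is followed across the boundary after a prefix: \<open>None\<close> stands for the start node as a
  source and for an arbitrary accepting node as a target.
\<close>

definition ports :: "('q, 'a, 'g) sa \<Rightarrow> (bool \<times> 'q) option set" where
  "ports M = insert None (Some ` (UNIV \<times> states M))"

fun port_node :: "('q, 'a, 'g) sa \<Rightarrow> nat \<Rightarrow> (bool \<times> 'q) option \<Rightarrow> 'q node" where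
  "port_node M n None = (False, start M, 0)"
| "port_node M n (Some (h, q)) = (h, q, n)"

text \<open>This is Shepherdson's table for two-way automata. The ports other than
  \<open>None\<close> lie on the last cell of the prefix, and the walks between ports stay inside
  the prefix.\<close>

definition behaviour ::
  "('q, 'a, 'g) sa \<Rightarrow> 'q set \<Rightarrow> ('g stack_sym \<times> bool) list \<Rightarrow>
    ((bool \<times> 'q) option \<times> (bool \<times> 'q) option) set" where
  "behaviour M F t = {(v, v'). v \<in> ports M \<and> v' \<in> ports M \<and>
     (case v' of None \<Rightarrow> \<exists>q\<in>F. \<exists>i. reach M t (port_node M (length t - 1) v) (True, q, i)
      | Some (h, p) \<Rightarrow> reach M t (port_node M (length t - 1) v) (h, p, length t - 1))}"

text \<open>A walk over \<open>s @ x # z\<close> is transferred piece by piece: positions beyond the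
  boundary are shifted, and each excursion into the prefix is exchanged for one over
  \<open>s' @ [x]\<close> with the same ports. The cell \<open>x\<close> is shared because edges on
  both sides scan it.\<close>

lemma behaviour_right_congruence:
  assumes M: "stack_automaton M"
    and beh: "behaviour M F (s @ [x]) = behaviour M F (s' @ [x])"
    and acc: "accepts_tape M F (s @ x # z)"
  shows "accepts_tape M F (s' @ x # z)"
proof -
  let ?t = "s @ x # z" and ?t' = "s' @ x # z" and ?n = "length s" and ?n' = "length s'"
  let ?s = "(False, start M, 0)"
  \<comment> \<open>Inside the prefix nothing corresponds to the current position on
    \<open>?t'\<close>. Only the port where the current excursion began is transferred; the
    excursion itself still runs over \<open>s @ [x]\<close>.\<close>
  let ?L = "\<lambda>h q i. \<exists>v\<in>ports M. reach M ?t' ?s (port_node M ?n' v) \<and>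
    reach M (s @ [x]) (port_node M ?n v) (h, q, i)"
  let ?R = "\<lambda>h q i. reach M ?t' ?s (h, q, i - ?n + ?n')"
  let ?I = "\<lambda>h q i. q \<in> states M \<and> (i \<le> ?n \<longrightarrow> ?L h q i) \<and> (?n < i \<longrightarrow> ?R h q i)"
  have lift: "reach M ?t' c d" if "reach M (s' @ [x]) c d" for c d
    using reach_append[OF that, of z] by simp
  have cross: "?R h q ?n" if L: "?L h q ?n" and q: "q \<in> states M" for h q
  proof -
    obtain v where v: "v \<in> ports M" "reach M ?t' ?s (port_node M ?n' v)"
      "reach M (s @ [x]) (port_node M ?n v) (h, q, ?n)" using L by blast
    have "(v, Some (h, q)) \<in> behaviour M F (s @ [x])"
      using v q by (auto simp: behaviour_def ports_def)
    then have "reach M (s' @ [x]) (port_node M ?n' v) (h, q, ?n')"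
      unfolding beh by (simp add: behaviour_def)
    from rtranclp_trans[OF v(2) lift[OF this]] show ?thesis by simp
  qed
  have inv: "?I h q i" if "reach M ?t ?s c" "c = (h, q, i)" for c h q i
    using that
  proof (induction arbitrary: h q i rule: rtranclp_induct)
    case base
    have "None \<in> ports M" by (simp add: ports_def)
    then show ?case using base M
      by (auto simp: stack_automaton_def intro!: bexI[of _ None])
  next
    case (step c d)
    obtain h0 q0 i0 where c: "c = (h0, q0, i0)" by (cases c) auto
    have I: "?I h0 q0 i0" using step.IH c by blast
    obtain a where e: "gedge M ?t a (h0, q0, i0) (h, q, i)" using step.hyps c step.prems by blast
    have q: "q \<in> states M" using gedge_state[OF M e] .
    from gedge_split[OF e] show ?case
    proof (elim disjE exE conjE)
      assume e1: "gedge M (s @ [x]) a (h0, q0, i0) (h, q, i)"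
      then have "i0 \<le> ?n" "i \<le> ?n" using gedge_bounded[OF e1] by auto
      moreover from this I obtain v where "v \<in> ports M" "reach M ?t' ?s (port_node M ?n' v)"
        "reach M (s @ [x]) (port_node M ?n v) (h0, q0, i0)" by blast
      moreover from this(3) have "reach M (s @ [x]) (port_node M ?n v) (h, q, i)"
        by (rule rtranclp.rtrancl_into_rtrancl) (use e1 in blast)
      ultimately show ?thesis using q by auto
    next
      fix i' j' assume ij: "i0 = ?n + i'" "i = ?n + j'" and e2: "gedge M (x # z) a (h0, q0, i') (h, q, j')"
      have "?R h0 q0 i0"
      proof (cases "i0 \<le> ?n")
        case True
        then have i0: "i0 = ?n" using ij by simp
        have "?L h0 q0 ?n" using I unfolding i0 by blast
        then show ?thesis using cross[of h0 q0] I unfolding i0 by blast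
      qed (use I in auto)
      moreover have "gedge M ?t' a (h0, q0, ?n' + i') (h, q, ?n' + j')" by (rule gedge_prepend[OF e2])
      ultimately have "reach M ?t' ?s (h0, q0, ?n' + i')" "gedge M ?t' a (h0, q0, ?n' + i') (h, q, ?n' + j')"
        by (simp_all add: ij(1) add.commute)
      then have r: "reach M ?t' ?s (h, q, ?n' + j')"
        by (blast intro: rtranclp.rtrancl_into_rtrancl)
      \<comment> \<open>Arriving at the boundary from the right opens a new excursion with the
        arrival node as its port.\<close>
      have "?L h q i" if "i \<le> ?n"
        using that r ij q by (auto simp: ports_def intro!: bexI[of _ "Some (h, q)"])
      then show ?thesis using r ij q by (simp add: add.commute)
    qed
  qed
  obtain q i where qi: "q \<in> F" "reach M ?t ?s (True, q, i)"
    using acc unfolding accepts_tape_def by blast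
  have I: "?I True q i" using inv[OF qi(2)] by blast
  show ?thesis
  proof (cases "i \<le> ?n")
    case True
    then obtain v where v: "v \<in> ports M" "reach M ?t' ?s (port_node M ?n' v)"
      "reach M (s @ [x]) (port_node M ?n v) (True, q, i)" using I by blast
    \<comment> \<open>The walk ends inside the prefix, where its last node has no counterpart. The
      target \<open>None\<close> transfers only that some accepting node is reached.\<close>
    have "(v, None) \<in> behaviour M F (s @ [x])"
      using v qi by (auto simp: behaviour_def ports_def)
    then obtain q' i' where "q' \<in> F" "reach M (s' @ [x]) (port_node M ?n' v) (True, q', i')"
      unfolding beh by (auto simp: behaviour_def)
    then show ?thesis using v(2) lift unfolding accepts_tape_def by (meson rtranclp_trans)
  next
    case False
    then show ?thesis using I qi(1) unfolding accepts_tape_def by auto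
  qed
qed

section \<open>Words as tapes and the finitely many classes of prefixes\<close>

text \<open>It is separate from \<open>tape\<close> because prefixes and stacks under construction
  have no top marker yet. The marker cells carry the flag \<open>False\<close>, so input may always
  be read on them; this costs only an additive constant.\<close>

definition left_tape :: "('g \<times> bool) list \<Rightarrow> ('g stack_sym \<times> bool) list" where
  "left_tape w = (Bottom, False) # map (map_prod Sym id) w"

definition tape :: "('g \<times> bool) list \<Rightarrow> ('g stack_sym \<times> bool) list" where
  "tape w = left_tape w @ [(Top, False)]"

definition accepts :: "('q, 'a, 'g) sa \<Rightarrow> 'q set \<Rightarrow> ('g \<times> bool) list \<Rightarrow> bool" where
  "accepts M F w \<longleftrightarrow> w \<in> lists (work M \<times> UNIV) \<and> accepts_tape M F (tape w)"

text \<open>The last cell is part of the class because the congruence above needs equal boundary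
  cells.\<close>

definition word_class where
  "word_class M F w = (last (left_tape w), behaviour M F (left_tape w))"

text \<open>The number \<open>2 * n + 1\<close> bounds both the possible last cells
  (\<open>Bottom\<close>, or a symbol with a flag) and the ports (\<open>None\<close>, or a phase
  with a state). The power counts the relations on ports.\<close>

definition class_bound :: "nat \<Rightarrow> nat" where
  "class_bound n = (2 * n + 1) * 2 ^ ((2 * n + 1) * (2 * n + 1))"

lemma word_class_congruence:
  assumes "stack_automaton M" "word_class M F w = word_class M F w'"
    "accepts M F (w @ z)" "w' \<in> lists (work M \<times> UNIV)"
  shows "accepts M F (w' @ z)"
proof -
  obtain s x where s: "left_tape w = s @ [x]"
    by (metis left_tape_def list.distinct(1) rev_exhaust)
  obtain s' x' where s': "left_tape w' = s' @ [x']"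
    by (metis left_tape_def list.distinct(1) rev_exhaust)
  have "x' = x" "behaviour M F (s @ [x]) = behaviour M F (s' @ [x])"
    using assms(2) s s' by (auto simp: word_class_def)
  moreover have "tape (v @ z) = left_tape v @ map (map_prod Sym id) z @ [(Top, False)]"
    for v :: "('c \<times> bool) list"
    by (simp add: tape_def left_tape_def)
  ultimately show ?thesis
    using behaviour_right_congruence[OF assms(1), of F s x s' "map (map_prod Sym id) z @ [(Top, False)]"]
      assms s s' by (auto simp: accepts_def)
qed

lemma word_class_finite:
  assumes "stack_automaton M" "card (states M) \<le> n" "card (work M) \<le> n"
  obtains C where "finite C" "card C \<le> class_bound n"
    "\<And>w. w \<in> lists (work M \<times> UNIV) \<Longrightarrow> word_class M F w \<in> C"
proof
  let ?A = "insert (Bottom, False) (map_prod Sym id ` (work M \<times> (UNIV :: bool set)))"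
  let ?C = "?A \<times> Pow (ports M \<times> ports M)"
  have fin: "finite (states M)" "finite (work M)" using assms(1) by (auto simp: stack_automaton_def)
  then have fp: "finite (ports M)" by (simp add: ports_def)
  show "finite ?C" using fin fp by simp
  have "card ?A \<le> Suc (card (map_prod (Sym :: 'c \<Rightarrow> _) id ` (work M \<times> (UNIV :: bool set))))"
    by (rule card_insert_le_m1) auto
  also have "\<dots> \<le> Suc (card (work M \<times> (UNIV :: bool set)))"
    using fin by (intro Suc_leI le_imp_less_Suc card_image_le) auto
  also have "\<dots> \<le> 2 * n + 1" using assms(3) by (simp add: card_cartesian_product)
  finally have A: "card ?A \<le> 2 * n + 1" .
  have "card (ports M) \<le> Suc (card (Some ` ((UNIV :: bool set) \<times> states M)))"
    unfolding ports_def by (rule card_insert_le_m1) auto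
  also have "\<dots> \<le> 2 * n + 1"
    using assms(2) by (simp add: card_image card_cartesian_product)
  finally have "card (ports M) \<le> 2 * n + 1" .
  then have "card (ports M \<times> ports M) \<le> (2 * n + 1) * (2 * n + 1)"
    unfolding card_cartesian_product by (intro mult_le_mono)
  then have "card (Pow (ports M \<times> ports M)) \<le> 2 ^ ((2 * n + 1) * (2 * n + 1))"
    using power_increasing[of _ _ "2 :: nat"] fp by (simp only: card_Pow finite_cartesian_product)
  then show "card ?C \<le> class_bound n"
    unfolding class_bound_def card_cartesian_product by (rule mult_le_mono[OF A])
  fix w assume w: "w \<in> lists (work M \<times> (UNIV :: bool set))"
  have "last (left_tape w) \<in> set (left_tape w)" unfolding left_tape_def by (rule last_in_set) simp
  also have "\<dots> \<subseteq> ?A" using w by (auto simp: left_tape_def)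
  finally have "last (left_tape w) \<in> ?A" .
  moreover have "behaviour M F (left_tape w) \<subseteq> ports M \<times> ports M" by (auto simp: behaviour_def)
  ultimately show "word_class M F w \<in> ?C" by (simp add: word_class_def)
qed

text \<open>Pigeonhole on the prefixes of \<open>y\<close> of lengths \<open>0\<close> to
  \<open>class_bound n\<close>. Staying within these lengths limits the factor that pumping
  removes.\<close>

lemma equal_prefix_classes:
  assumes "stack_automaton M" "card (states M) \<le> n" "card (work M) \<le> n"
    "w @ y \<in> lists (work M \<times> UNIV)" "class_bound n \<le> length y"
  obtains i j where "i < j" "j \<le> class_bound n"
    "word_class M F (w @ take i y) = word_class M F (w @ take j y)"
proof -
  obtain C where C: "finite C" "card C \<le> class_bound n"
    "\<And>w. w \<in> lists (work M \<times> UNIV) \<Longrightarrow> word_class M F w \<in> C"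
    using word_class_finite[OF assms(1-3), where F = F] by blast
  let ?f = "\<lambda>i. word_class M F (w @ take i y)"
  have "?f ` {..class_bound n} \<subseteq> C"
    using assms(4) by (intro image_subsetI C(3)) (auto simp: lists_eq_set dest!: in_set_takeD)
  then have "card (?f ` {..class_bound n}) \<le> class_bound n"
    using C(1,2) card_mono le_trans by blast
  then have "\<not> inj_on ?f {..class_bound n}"
    using card_image[of ?f "{..class_bound n}"] by auto
  then obtain i j where "i \<le> class_bound n" "j \<le> class_bound n" "i \<noteq> j" "?f i = ?f j"
    by (auto simp: inj_on_def)
  then show ?thesis using that[of i j] that[of j i] by (cases "i < j") auto
qed

section \<open>Pumping\<close>

text \<open>The factor between two equivalent prefixes is cut out. That at most
  \<open>class_bound n\<close> letters disappear is what later bounds the gaps between lengths of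
  accepted words.\<close>

lemma pump_down:
  assumes M: "stack_automaton M" "card (states M) \<le> n" "card (work M) \<le> n"
    and acc: "accepts M F (w @ y @ z)" and y: "class_bound n \<le> length y"
  obtains y' where "set y' \<subseteq> set y" "length y' < length y" "length y \<le> length y' + class_bound n"
    "accepts M F (w @ y' @ z)"
proof -
  have l: "w @ y \<in> lists (work M \<times> UNIV)" using acc by (auto simp: accepts_def)
  obtain i j where ij: "i < j" "j \<le> class_bound n"
    "word_class M F (w @ take i y) = word_class M F (w @ take j y)"
    using equal_prefix_classes[OF M l y] by blast
  have "accepts M F ((w @ take i y) @ drop j y @ z)"
  proof (rule word_class_congruence[OF M(1) ij(3)[symmetric]])
    show "accepts M F ((w @ take j y) @ drop j y @ z)"
      using acc by (simp flip: append_assoc) (simp add: append_assoc)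
    show "w @ take i y \<in> lists (work M \<times> UNIV)" using l by (auto dest: in_set_takeD)
  qed
  moreover have "set (take i y @ drop j y) \<subseteq> set y"
    by (auto dest: in_set_takeD in_set_dropD)
  ultimately show ?thesis using that[of "take i y @ drop j y"] ij y by auto
qed

text \<open>Repeating the factor between two equivalent prefixes adds at least one letter, and this
  can be iterated. Since only letters of \<open>y\<close> are reused, a quiet block stays
  quiet.\<close>

lemma pump_up:
  assumes M: "stack_automaton M" "card (states M) \<le> n" "card (work M) \<le> n"
    and acc: "accepts M F (w @ y @ z)" and y: "class_bound n \<le> length y"
  obtains y' where "set y' \<subseteq> set y" "N \<le> length y'" "accepts M F (w @ y' @ z)"
proof -
  have "\<exists>y'. set y' \<subseteq> set y \<and> N \<le> length y' \<and> class_bound n \<le> length y' \<and> accepts M F (w @ y' @ z)"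
  proof (induction N)
    case 0 then show ?case using acc y by auto
  next
    case (Suc N)
    then obtain x where x: "set x \<subseteq> set y" "N \<le> length x" "class_bound n \<le> length x"
      "accepts M F (w @ x @ z)" by blast
    have l: "w @ x \<in> lists (work M \<times> UNIV)" using x by (auto simp: accepts_def)
    obtain i j where ij: "i < j" "j \<le> class_bound n"
      "word_class M F (w @ take i x) = word_class M F (w @ take j x)"
      using equal_prefix_classes[OF M l x(3)] by blast
    have "accepts M F ((w @ take j x) @ drop i x @ z)"
    proof (rule word_class_congruence[OF M(1) ij(3)])
      show "accepts M F ((w @ take i x) @ drop i x @ z)"
        using x by (simp flip: append_assoc) (simp add: append_assoc)
      show "w @ take j x \<in> lists (work M \<times> UNIV)" using l by (auto dest: in_set_takeD)
    qed
    moreover have "set (take j x @ drop i x) \<subseteq> set x"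
      by (auto dest: in_set_takeD in_set_dropD)
    ultimately show ?case using x ij by (intro exI[of _ "take j x @ drop i x"]) auto
  qed
  then show ?thesis using that by blast
qed

section \<open>Walks and computations\<close>

lemma rtranclp_iff_successively:
  "r\<^sup>*\<^sup>* x y \<longleftrightarrow> (\<exists>cs. cs \<noteq> [] \<and> hd cs = x \<and> last cs = y \<and> successively r cs)"
proof
  assume "r\<^sup>*\<^sup>* x y"
  then show "\<exists>cs. cs \<noteq> [] \<and> hd cs = x \<and> last cs = y \<and> successively r cs"
  proof (induction rule: rtranclp_induct)
    case base then show ?case by (intro exI[of _ "[x]"]) auto
  next
    case (step y z)
    then obtain cs where "cs \<noteq> []" "hd cs = x" "last cs = y" "successively r cs" by blast
    then show ?case using step.hyps
      by (intro exI[of _ "cs @ [z]"]) (auto simp: successively_append_iff)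
  qed
next
  have "r\<^sup>*\<^sup>* (hd cs) (last cs)" if "cs \<noteq> []" "successively r cs" for cs
    using that by (induction cs rule: induct_list012) (auto intro: converse_rtranclp_into_rtranclp)
  then show "\<exists>cs. cs \<noteq> [] \<and> hd cs = x \<and> last cs = y \<and> successively r cs \<Longrightarrow> r\<^sup>*\<^sup>* x y" by blast
qed

section \<open>Space as a supremum of final stack sizes\<close>

text \<open>Only the last configuration is inspected: without erasing, no earlier stack is
  larger.\<close>

definition attains :: "space_kind \<Rightarrow> ('q, 'a, 'g) sa \<Rightarrow> 'a list \<Rightarrow> nat \<Rightarrow> bool" where
  "attains z M u m \<longleftrightarrow> (\<exists>c. (step M)\<^sup>*\<^sup>* (start M, u, [Bottom], [Top]) c \<and> stack_size c = m \<and>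
     (z = Accept \<longrightarrow> fst (snd c) = [] \<and> fst c \<in> final M))"

fun target_states :: "space_kind \<Rightarrow> ('q, 'a, 'g) sa \<Rightarrow> 'q set" where
  "target_states Accept M = final M"
| "target_states Strong M = states M"

lemma stack_size_mono:
  assumes "non_erasing M" "step M c d"
  shows "stack_size c \<le> stack_size d"
  using assms(2) unfolding step_def
proof
  assume "write_step M c d"
  then show ?thesis using assms(1) by cases (auto simp: non_erasing_def)
next
  assume "read_step M c d"
  then show ?thesis by cases auto
qed

lemma computation_size_last:
  assumes "non_erasing M" "cs \<noteq> []" "successively (step M) cs"
  shows "computation_size cs = stack_size (last cs)"
proof -
  have "\<forall>c \<in> set cs. stack_size c \<le> stack_size (last cs)"
    using assms(2,3)
  proof (induction cs rule: rev_nonempty_induct)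
    case (snoc c cs)
    then have "stack_size (last cs) \<le> stack_size c"
      by (intro stack_size_mono[OF assms(1)]) (simp add: successively_append_iff)
    moreover have "\<forall>d \<in> set cs. stack_size d \<le> stack_size (last cs)"
      using snoc by (simp add: successively_append_iff)
    ultimately show ?case by (auto intro: le_trans)
  qed auto
  then show ?thesis unfolding computation_size_def using assms(2) by (intro Max_eqI) auto
qed

lemma word_space_eq:
  assumes "non_erasing M" "u \<in> lists (inputs M)"
  shows "word_space z M u = (SUP m\<in>{m. attains z M u m}. enat m)"
proof -
  have sz: "{m. attains z M u m} = computation_size `
     {cs. if z = Accept then accepting_computation M u cs else partial_computation M u cs}"
    (is "?L = computation_size ` ?R")
  proof (intro set_eqI iffI)
    fix m assume "m \<in> ?L"
    then obtain c where c: "(step M)\<^sup>*\<^sup>* (start M, u, [Bottom], [Top]) c" "stack_size c = m"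
      "z = Accept \<longrightarrow> fst (snd c) = [] \<and> fst c \<in> final M" unfolding attains_def by blast
    then obtain cs where "cs \<noteq> []" "hd cs = (start M, u, [Bottom], [Top])" "last cs = c"
      "successively (step M) cs" unfolding rtranclp_iff_successively by blast
    then show "m \<in> computation_size ` ?R"
      using c computation_size_last[OF assms(1)]
      by (intro image_eqI[of _ _ cs])
        (auto simp: accepting_computation_def computation_def partial_computation_def)
  next
    fix m assume "m \<in> computation_size ` ?R"
    then obtain cs where cs: "m = computation_size cs" "cs \<in> ?R" by blast
    then have p: "cs \<noteq> []" "hd cs = (start M, u, [Bottom], [Top])" "successively (step M) cs"
      "z = Accept \<longrightarrow> fst (snd (last cs)) = [] \<and> fst (last cs) \<in> final M"
      by (auto simp: accepting_computation_def computation_def partial_computation_def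
          split: if_splits)
    then have "(step M)\<^sup>*\<^sup>* (start M, u, [Bottom], [Top]) (last cs)"
      unfolding rtranclp_iff_successively by blast
    then show "m \<in> ?L"
      using p computation_size_last[OF assms(1) p(1,3)] cs(1)
      unfolding attains_def mem_Collect_eq by (intro exI[of _ "last cs"]) simp
  qed
  show ?thesis
  proof (cases z)
    case Accept
    show ?thesis
    proof (cases "u \<in> language M")
      case True
      then show ?thesis using Accept sz by (simp add: image_image)
    next
      case False
      then have "{m. attains z M u m} = {}" using sz Accept assms(2) by (auto simp: language_def)
      \<comment> \<open>The empty supremum is \<open>0\<close>, in agreement with the value fixed
        for words outside the language.\<close>
      then show ?thesis using Accept False by (simp add: bot_enat_def)
    qed
  next
    case Strong
    then show ?thesis using sz by (simp add: image_image)
  qed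
qed

section \<open>From computations to walks\<close>

abbreviation loud_count :: "('g \<times> bool) list \<Rightarrow> nat" where
  "loud_count w \<equiv> length (filter (\<lambda>x. \<not> snd x) w)"

text \<open>Makes the cell at tape position \<open>i\<close> loud when a letter is read there.
  Position \<open>0\<close> is the bottom marker, hence the shift by one; the markers are loud
  already, so there the word is left alone.\<close>

definition loosen :: "('g \<times> bool) list \<Rightarrow> 'a option \<Rightarrow> nat \<Rightarrow> ('g \<times> bool) list" where
  "loosen w a i = (if a = None \<or> i = 0 \<or> length w < i then w
     else w[i - 1 := (fst (w ! (i - 1)), False)])"

lemma length_loosen [simp]: "length (loosen w a i) = length w"
  by (simp add: loosen_def)

lemma map_fst_loosen [simp]: "map fst (loosen w a i) = map fst w"
  by (auto simp: loosen_def map_update intro: list_update_same_conv[THEN iffD2])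

lemma loud_count_loosen: "loud_count (loosen w a i) \<le> loud_count w + length (label_word a)"
proof -
  have "loud_count (w[k := x]) \<le> Suc (loud_count w)" for k x
    by (induction w arbitrary: k) (auto split: nat.split)
  then show ?thesis by (cases a) (auto simp: loosen_def)
qed

lemma marked_lists_iff: "w \<in> lists (A \<times> UNIV) \<longleftrightarrow> set (map fst w) \<subseteq> A"
  by (auto simp: lists_eq_set)

lemma loosen_in_lists: "w \<in> lists (A \<times> UNIV) \<Longrightarrow> loosen w a i \<in> lists (A \<times> UNIV)"
  unfolding marked_lists_iff by simp

lemma length_left_tape [simp]: "length (left_tape w) = Suc (length w)"
  by (simp add: left_tape_def)

lemma length_tape [simp]: "length (tape w) = Suc (Suc (length w))"
  by (simp add: tape_def)

lemma map_fst_left_tape: "map fst (left_tape w) = Bottom # map Sym (map fst w)"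
  by (simp add: left_tape_def)

lemma map_fst_tape: "map fst (tape w) = Bottom # map Sym (map fst w) @ [Top]"
  by (simp add: tape_def map_fst_left_tape)

lemma snd_left_tape: "i < Suc (length w) \<Longrightarrow> snd (left_tape w ! i) \<longleftrightarrow> 0 < i \<and> snd (w ! (i - 1))"
  by (cases i) (auto simp: left_tape_def)

lemma snd_tape:
  "i < Suc (Suc (length w)) \<Longrightarrow> snd (tape w ! i) \<longleftrightarrow> 0 < i \<and> i \<le> length w \<and> snd (w ! (i - 1))"
  by (auto simp: tape_def nth_append snd_left_tape)

text \<open>A flag only forbids edges. So the walk built so far remains valid when a later letter
  forces one of its cells to become loud.\<close>

lemma gedge_mono:
  assumes "gedge M t a c d" "map fst t' = map fst t"
    "\<And>i. i < length t \<Longrightarrow> snd (t' ! i) \<Longrightarrow> snd (t ! i)"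
  shows "gedge M t' a c d"
proof -
  have l: "length t' = length t" using assms(2) by (metis length_map)
  then have f: "i < length t \<Longrightarrow> fst (t' ! i) = fst (t ! i)" for i
    using assms(2) by (metis nth_map)
  show ?thesis using assms(1)
    by cases (use assms(3) in \<open>auto intro!: gedge.intros simp: f l\<close>)
qed

lemma reach_mono:
  assumes "reach M t c d" "map fst t' = map fst t"
    "\<And>i. i < length t \<Longrightarrow> snd (t' ! i) \<Longrightarrow> snd (t ! i)"
  shows "reach M t' c d"
  using assms(1) by (rule rtranclp_mono[THEN predicate2D, rotated]) (use gedge_mono assms(2,3) in blast)

lemma snd_loosen: "i < length w \<Longrightarrow> snd (loosen w a j ! i) \<Longrightarrow> snd (w ! i)"
  by (auto simp: loosen_def nth_list_update split: if_splits)

lemma reach_left_loosen: "reach M (left_tape w) c d \<Longrightarrow> reach M (left_tape (loosen w a j)) c d"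
  by (erule reach_mono) (auto simp: map_fst_left_tape snd_left_tape dest: snd_loosen[rotated])

lemma reach_loosen: "reach M (tape w) c d \<Longrightarrow> reach M (tape (loosen w a j)) c d"
  by (erule reach_mono) (auto simp: map_fst_tape snd_tape dest: snd_loosen[rotated])

lemma snd_left_tape_loosen: "i \<le> length w \<Longrightarrow> snd (left_tape (loosen w a i) ! i) \<Longrightarrow> a = None"
  by (auto simp: snd_left_tape loosen_def split: if_splits)

lemma snd_tape_loosen: "i \<le> Suc (length w) \<Longrightarrow> snd (tape (loosen w a i) ! i) \<Longrightarrow> a = None"
  by (auto simp: snd_tape loosen_def split: if_splits)

lemma reach_step: "reach M t c d \<Longrightarrow> gedge M t a d e \<Longrightarrow> reach M t c e"
  by (rule rtranclp.rtrancl_into_rtrancl) auto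

lemma reach_switch:
  assumes "reach M (left_tape w) c (False, q, length w)" "q \<in> states M"
  shows "reach M (tape w) c (True, q, length w)"
proof -
  have "reach M (tape w) c (False, q, length w)"
    unfolding tape_def by (rule reach_append[OF assms(1)])
  moreover have "gedge M (tape w) None (False, q, length w) (True, q, length w)"
    using assms(2) by (intro gedge.switch) (simp_all add: tape_def nth_append)
  ultimately show ?thesis by (rule reach_step)
qed

text \<open>The walk runs over the tape without its top marker, so that a push merely appends a
  cell. Adding the marker is what enables \<open>switch\<close>.\<close>

definition write_config where
  "write_config M w q l r \<longleftrightarrow> r = [Top] \<and> l = map fst (left_tape w) \<and>
     reach M (left_tape w) (False, start M, 0) (False, q, length w)"

definition read_config where
  "read_config M w q l r \<longleftrightarrow> l \<noteq> [] \<and> l @ r = map fst (tape w) \<and>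
     reach M (tape w) (False, start M, 0) (True, q, length l - 1)"

lemma read_config_if_write_config:
  "write_config M w q l r \<Longrightarrow> q \<in> states M \<Longrightarrow> read_config M w q l r"
  unfolding write_config_def read_config_def
  by (auto simp: reach_switch map_fst_left_tape map_fst_tape)

lemma fst_left_tape_loosen:
  assumes "map fst (left_tape w) = g @ [x]"
  shows "fst (left_tape (loosen w a i) ! length w) = x"
proof -
  have "map fst (left_tape (loosen w a i)) = g @ [x]"
    using assms by (simp add: map_fst_left_tape)
  moreover have "length g = length w" using arg_cong[OF assms, of length] by simp
  ultimately have "map fst (left_tape (loosen w a i)) ! length w = x"
    by (metis nth_append_length)
  then show ?thesis by simp
qed

text \<open>Each consumed letter pays for at most one newly loud cell, so loud cells plus remaining
  letters never increase.\<close>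

lemma write_config_step:
  assumes M: "stack_automaton M" "non_erasing M" and w: "w \<in> lists (work M \<times> UNIV)"
    and inv: "write_config M w q l r" and step: "write_step M (q, v, l, r) (q', v', l', r')"
  obtains w' where "w' \<in> lists (work M \<times> UNIV)" "write_config M w' q' l' r'"
    "loud_count w' + length v' \<le> loud_count w + length v"
proof -
  from step show ?thesis
  proof cases
    case (stay a x g)
    let ?w = "loosen w a (length w)"
    have x: "fst (left_tape ?w ! length w) = x"
      using inv stay by (intro fst_left_tape_loosen[of w g]) (simp add: write_config_def)
    have "gedge M (left_tape ?w) a (False, q, length w) (False, q', length w)"
      using stay snd_left_tape_loosen[of "length w" w a] x by (intro gedge.stay) auto
    then have "write_config M ?w q' l' r'"
      using inv stay by (auto simp: write_config_def map_fst_left_tape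
          intro!: reach_step[OF reach_left_loosen])
    then show ?thesis
      using that[of ?w] loosen_in_lists[OF w] loud_count_loosen[of w a "length w"] stay by auto
  next
    case (push a x y g)
    \<comment> \<open>The letter is read on the old topmost cell, which is loosened; the new cell
      starts quiet.\<close>
    let ?w = "loosen w a (length w)" and ?w' = "loosen w a (length w) @ [(y, True)]"
    have x: "fst (left_tape ?w ! length w) = x"
      using inv push by (intro fst_left_tape_loosen[of w g]) (simp add: write_config_def)
    have e: "left_tape ?w' = left_tape ?w @ [(Sym y, True)]" by (simp add: left_tape_def)
    have y: "y \<in> work M" using push trans_rel_wf[OF M(1), of q a x q' "Push y"] by (auto simp: instrs_def)
    have "gedge M (left_tape ?w') a (False, q, length w) (False, q', Suc (length w))"
      unfolding e using push snd_left_tape_loosen[of "length w" w a] x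
      by (intro gedge.push[where y = y]) (auto simp: nth_append)
    moreover have "reach M (left_tape ?w') (False, start M, 0) (False, q, length w)"
      unfolding e using inv
      by (intro reach_append reach_left_loosen) (auto simp: write_config_def)
    ultimately have "reach M (left_tape ?w') (False, start M, 0) (False, q', Suc (length w))"
      by (rule reach_step[rotated])
    then have "write_config M ?w' q' l' r'"
      using inv push by (auto simp: write_config_def map_fst_left_tape)
    then show ?thesis
      using that[of ?w'] loosen_in_lists[OF w, of a "length w"]
        loud_count_loosen[of w a "length w"] push y by auto
  next
    case (pop a x)
    then show ?thesis using M(2) by (auto simp: non_erasing_def)
  qed
qed

lemma read_config_step:
  assumes w: "w \<in> lists (work M \<times> UNIV)"
    and inv: "read_config M w q l r" and step: "read_step M (q, v, l, r) (q', v', l', r')"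
  obtains w' where "w' \<in> lists (work M \<times> UNIV)" "read_config M w' q' l' r'"
    "loud_count w' + length v' \<le> loud_count w + length v"
proof -
  note result = that
  \<comment> \<open>The three moves differ only in their edge. The edge is required for every
    admissible \<open>w'\<close> because the marking changes before it is used.\<close>
  have *: ?thesis if v: "v = label_word a @ v'" and l: "l = g @ [x]" "l' \<noteq> []" "l' @ r' = l @ r"
    and e: "\<And>w'. \<lbrakk>length w' = length w; fst (tape w' ! length g) = x;
      snd (tape w' ! length g) \<longrightarrow> a = None\<rbrakk> \<Longrightarrow>
      gedge M (tape w') a (True, q, length g) (True, q', length l' - 1)" for a x g
  proof -
    let ?w = "loosen w a (length g)"
    have m: "map fst (tape ?w) = l @ r" using inv by (simp add: read_config_def map_fst_tape)
    have ln: "length g \<le> Suc (length w)" using arg_cong[OF m, of length] l by simp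
    have "map fst (tape ?w) ! length g = x" unfolding m l by (simp add: nth_append)
    then have "fst (tape ?w ! length g) = x" using ln by simp
    then have "gedge M (tape ?w) a (True, q, length g) (True, q', length l' - 1)"
      using snd_tape_loosen[OF ln, of a] by (intro e) auto
    moreover have "reach M (tape ?w) (False, start M, 0) (True, q, length g)"
      using inv l by (intro reach_loosen) (auto simp: read_config_def)
    ultimately have "reach M (tape ?w) (False, start M, 0) (True, q', length l' - 1)"
      by (rule reach_step[rotated])
    then have "read_config M ?w q' l' r'" using m l by (simp add: read_config_def)
    then show ?thesis
      using result[of ?w] loosen_in_lists[OF w] loud_count_loosen[of w a "length g"] v by auto
  qed
  have lr: "l @ r = map fst (tape w)" using inv by (simp add: read_config_def)
  have len: "length l + length r = Suc (Suc (length w))" using arg_cong[OF lr, of length] by simp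
  from step show ?thesis
  proof cases
    case (down a x)
    have ne: "l' \<noteq> []" using lr down by (auto simp: map_fst_tape)
    have "gedge M (tape w') a (True, q, length l') (True, q', length l' - 1)"
      if "length w' = length w" "fst (tape w' ! length l') = x"
        "snd (tape w' ! length l') \<longrightarrow> a = None" for w'
      using gedge.down[where i = "length l' - 1" and t = "tape w'" and q = q and a = a and p = q' and M = M] that down ne len by simp
    then show ?thesis using down ne by (intro *[where a = a and g = l' and x = x]) auto
  next
    case (here a x g)
    then show ?thesis using len by (intro *[where a = a and g = g and x = x]) (auto intro!: gedge.here)
  next
    case (up a x g y)
    then show ?thesis using len by (intro *[where a = a and g = g and x = x]) (auto intro!: gedge.up)
  qed
qed

text \<open>The marking is constructed along the computation. Partitioned states are essential:
  after the first read step no write step can follow, so the whole tape is known from then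
  on.\<close>

lemma accepts_if_attains:
  assumes M: "checking_stack_automaton M" and "attains z M u m"
  obtains w where "accepts M (target_states z M) w" "length w = m" "loud_count w \<le> length u"
proof -
  have sa: "stack_automaton M" "non_erasing M" using M by (auto simp: checking_stack_automaton_def)
  obtain Qw Qr where p: "partitioned_states M Qw Qr"
    "\<forall>(q, a, x, p, i) \<in> trans_rel M. \<not> (q \<in> Qr \<and> p \<in> Qw)"
    using M by (auto simp: checking_stack_automaton_def)
  have Q: "states M = Qw \<union> Qr" using p by (auto simp: partitioned_states_def)
  \<comment> \<open>The first alternative also covers a read state that has just been entered by a
    write transition, before any read step.\<close>
  let ?I = "\<lambda>(q, v, l, r). q \<in> states M \<and> (\<exists>w \<in> lists (work M \<times> UNIV).
     loud_count w + length v \<le> length u \<and>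
     (write_config M w q l r \<or> q \<in> Qr \<and> read_config M w q l r))"
  have inv: "?I c" if "(step M)\<^sup>*\<^sup>* (start M, u, [Bottom], [Top]) c" for c
    using that
  proof (induction rule: rtranclp_induct)
    case base
    then show ?case using sa(1)
      by (auto simp: stack_automaton_def write_config_def left_tape_def intro!: bexI[of _ "[]"])
  next
    case (step c d)
    obtain q v l r where c: "c = (q, v, l, r)" by (cases c) auto
    obtain q' v' l' r' where d: "d = (q', v', l', r')" by (cases d) auto
    from step.IH c obtain w where q: "q \<in> states M" and w: "w \<in> lists (work M \<times> UNIV)"
      "loud_count w + length v \<le> length u"
      "write_config M w q l r \<or> q \<in> Qr \<and> read_config M w q l r" by auto
    show ?case using step.hyps(2) unfolding step_def c d
    proof
      assume st: "write_step M (q, v, l, r) (q', v', l', r')"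
      then have "q \<notin> Qr \<and> q' \<in> states M"
        using p sa(1) by cases (auto simp: partitioned_states_def dest!: trans_rel_wf)
      moreover from this w have "write_config M w q l r" by blast
      from write_config_step[OF sa w(1) this st] obtain w' where
        "w' \<in> lists (work M \<times> UNIV)" "write_config M w' q' l' r'"
        "loud_count w' + length v' \<le> loud_count w + length v" .
      moreover from this(3) w(2) have "loud_count w' + length v' \<le> length u" by linarith
      ultimately show "?I (q', v', l', r')" unfolding prod.case by blast
    next
      assume st: "read_step M (q, v, l, r) (q', v', l', r')"
      then obtain a x i where t: "(q, a, x, q', i) \<in> trans_rel M" "i \<in> {Down, Here, Up}"
        by cases auto
      then have "q \<notin> Qw" using p by (auto simp: partitioned_states_def)
      then have "q \<in> Qr" using q Q by auto
      moreover have "q' \<in> states M" using t trans_rel_wf[OF sa(1)] by blast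
      ultimately have q': "q' \<in> Qr" using p(2) t Q by blast
      \<comment> \<open>At the first read step the walk must still take the \<open>switch\<close>
        edge; afterwards \<open>read_config\<close> is already available.\<close>
      have "read_config M w q l r" using w(3) read_config_if_write_config[OF _ q] by auto
      from read_config_step[OF w(1) this st] obtain w' where
        "w' \<in> lists (work M \<times> UNIV)" "read_config M w' q' l' r'"
        "loud_count w' + length v' \<le> loud_count w + length v" .
      moreover from this(3) w(2) have "loud_count w' + length v' \<le> length u" by linarith
      ultimately show "?I (q', v', l', r')" using q' \<open>q' \<in> states M\<close> unfolding prod.case by blast
    qed
  qed
  obtain q v l r where c: "(step M)\<^sup>*\<^sup>* (start M, u, [Bottom], [Top]) (q, v, l, r)"
    "length l + length r - 2 = m" "z = Accept \<longrightarrow> v = [] \<and> q \<in> final M"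
    using assms(2) unfolding attains_def by auto
  from inv[OF c(1)] obtain w where w: "q \<in> states M" "w \<in> lists (work M \<times> UNIV)"
    "loud_count w + length v \<le> length u" "read_config M w q l r"
    using read_config_if_write_config by fastforce
  have "length (l @ r) = Suc (Suc (length w))" using w(4) unfolding read_config_def by simp
  then have "length w = m" using c(2) by simp
  moreover have "q \<in> target_states z M" using c(3) w(1) by (cases z) auto
  then have "accepts M (target_states z M) w"
    using w unfolding accepts_def accepts_tape_def read_config_def by blast
  ultimately show ?thesis using that[of w] w(3) by simp
qed

section \<open>From loop-free walks back to computations\<close>

inductive gpath ::
  "('q, 'a, 'g) sa \<Rightarrow> ('g stack_sym \<times> bool) list \<Rightarrow>
    'q node \<Rightarrow> ('q node \<times> 'a option) list \<Rightarrow> 'q node \<Rightarrow> bool" for M t where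
  nil: "gpath M t c [] c"
| cons: "gedge M t a c d \<Longrightarrow> gpath M t d xs e \<Longrightarrow> gpath M t c ((c, a) # xs) e"

lemma gpath_suffix: "gpath M t c (ys @ (d, a) # zs) e \<Longrightarrow> gpath M t d ((d, a) # zs) e"
proof (induction ys arbitrary: c)
  case Nil
  then show ?case by (auto elim: gpath.cases intro: gpath.intros)
next
  case (Cons y ys)
  then show ?case by (auto elim: gpath.cases)
qed

text \<open>When a node reappears, the loop is dropped together with its labels. This is harmless
  because the input word is not fixed.\<close>

lemma distinct_gpath:
  assumes "reach M t c e"
  obtains xs where "gpath M t c xs e" "distinct (map fst xs)"
proof -
  from assms have "\<exists>xs. gpath M t c xs e \<and> distinct (map fst xs)"
  proof (induction rule: converse_rtranclp_induct)
    case base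
    then show ?case by (intro exI[of _ "[]"]) (auto intro: gpath.intros)
  next
    case (step c d)
    then obtain xs a where xs: "gpath M t d xs e" "distinct (map fst xs)" "gedge M t a c d" by blast
    show ?case
    proof (cases "c \<in> fst ` set xs")
      case True
      then obtain b where "(c, b) \<in> set xs" by auto
      then obtain ys zs where e: "xs = ys @ (c, b) # zs" by (auto dest: split_list)
      have "gpath M t c ((c, b) # zs) e" by (rule gpath_suffix) (use xs(1) e in blast)
      moreover have "distinct (map fst ((c, b) # zs))" using xs(2) e by simp
      ultimately show ?thesis by blast
    next
      case False
      then show ?thesis using xs by (intro exI[of _ "(c, a) # xs"]) (auto intro: gpath.intros)
    qed
  qed
  then show ?thesis using that by blast
qed

abbreviation path_word :: "('b \<times> 'a option) list \<Rightarrow> 'a list" where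
  "path_word xs \<equiv> concat (map (\<lambda>x. label_word (snd x)) xs)"

lemma gpath_source:
  assumes "gpath M t c xs e" "((h, q, i), Some b) \<in> set xs" "stack_automaton M"
  shows "q \<in> states M" "i < length t" "\<not> snd (t ! i)" "b \<in> inputs M"
proof -
  have "\<exists>d. gedge M t (Some b) (h, q, i) d" using assms(1,2) by induction auto
  then obtain d where "gedge M t (Some b) (h, q, i) d" ..
  then show "q \<in> states M" "i < length t" "\<not> snd (t ! i)" "b \<in> inputs M"
    by (cases, auto dest!: trans_rel_wf[OF assms(3)] simp: input_labels_def)+
qed

text \<open>Every letter is read at a node over a loud cell, and no source node repeats. Each loud
  cell therefore accounts for at most one letter per phase and state; the \<open>+ 2\<close> stands
  for the two markers.\<close>

lemma length_path_word:
  assumes M: "stack_automaton M" and p: "gpath M (tape w) c xs e" "distinct (map fst xs)"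
  shows "length (path_word xs) \<le> 2 * card (states M) * (loud_count w + 2)"
proof -
  let ?ys = "filter (\<lambda>x. snd x \<noteq> None) xs"
  let ?I = "{i. i < length (tape w) \<and> \<not> snd (tape w ! i)}"
  have "length (path_word xs) = length ?ys" by (induction xs) auto
  also have "\<dots> = card (set (map fst ?ys))"
    using distinct_card[OF distinct_map_filter[OF p(2)]] by simp
  also have "\<dots> \<le> card ((UNIV :: bool set) \<times> states M \<times> ?I)"
  proof (rule card_mono)
    show "finite ((UNIV :: bool set) \<times> states M \<times> ?I)" using M by (simp add: stack_automaton_def)
    show "set (map fst ?ys) \<subseteq> UNIV \<times> states M \<times> ?I"
      using gpath_source[OF p(1) _ M] by fastforce
  qed
  also have "\<dots> = 2 * card (states M) * card ?I" by (simp add: card_cartesian_product)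
  also have "card ?I = length (filter (\<lambda>x. \<not> snd x) (tape w))"
    by (rule length_filter_conv_card[symmetric])
  also have "\<dots> = loud_count w + 2"
    by (simp add: tape_def left_tape_def filter_map comp_def)
  finally show ?thesis .
qed

text \<open>While writing, the cells above the head are on the tape but not yet on the stack; the
  actual stack ends at the head and is followed by the top marker.\<close>

fun node_config where
  "node_config w (False, q, i) u = (q, u, take (Suc i) (map fst (tape w)), [Top])"
| "node_config w (True, q, i) u =
     (q, u, take (Suc i) (map fst (tape w)), drop (Suc i) (map fst (tape w)))"

text \<open>The condition on \<open>i\<close> keeps a writing head off the top marker, where
  \<open>stay\<close> would give an edge without a counterpart among the configurations. It is
  preserved because a push only moves onto a work symbol.\<close>

lemma gedge_steps:
  assumes M: "stack_automaton M" and w: "w \<in> lists (work M \<times> UNIV)" and u: "u \<in> lists (inputs M)"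
    and e: "gedge M (tape w) a (h, q, i) (h', p, j)" and i: "\<not> h \<longrightarrow> i \<le> length w"
  shows "(step M)\<^sup>*\<^sup>* (node_config w (h, q, i) (label_word a @ u)) (node_config w (h', p, j) u) \<and>
    (\<not> h' \<longrightarrow> j \<le> length w)"
proof -
  define T where "T = map fst (tape w)"
  have lT: "length T = Suc (Suc (length w))" by (simp add: T_def)
  have T: "T \<in> stacks M" using w
    by (auto simp: T_def stacks_def marked_lists_iff map_fst_tape intro!: exI[of _ "map fst w"])
  have tk: "take k T @ [T ! k, Top] \<in> stacks M" if "k \<le> length w" for k
  proof -
    have "take (Suc k) T = Bottom # map Sym (take k (map fst w))"
      using that by (simp add: T_def map_fst_tape take_map)
    then have "take k T @ [T ! k, Top] = Bottom # map Sym (take k (map fst w)) @ [Top]"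
      using that lT by (simp add: take_Suc_conv_app_nth)
    then show ?thesis using w
      unfolding marked_lists_iff by (auto simp: stacks_def dest!: in_set_takeD intro!: exI[of _ "take k (map fst w)"])
  qed
  have Ts: "take (Suc k) T = take k T @ [T ! k]" if "k < length T" for k
    using that by (rule take_Suc_conv_app_nth)
  have Td: "take k T @ T ! k # drop (Suc k) T = T" if "k < length T" for k
    using that by (rule id_take_nth_drop[symmetric])
  have tn: "fst (tape w ! k) = T ! k" if "k < length T" for k using that by (simp add: T_def)
  have top: "T ! Suc k \<noteq> Top" if "k < length w" for k
    using that by (simp add: T_def map_fst_tape nth_append)
  have sym: "Suc k \<le> length w" if "T ! Suc k = Sym y" "Suc k < length T" for k y
    using that by (auto simp: T_def map_fst_tape nth_append split: if_splits)
  from e show ?thesis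
  proof cases
    case stay
    then have "write_step M (q, label_word a @ u, take i T @ [T ! i], [Top])
        (p, u, take i T @ [T ! i], [Top])"
      using u i lT tn[of i] by (intro write_step.stay tk) auto
    then show ?thesis using stay i lT
      by (auto simp: step_def Ts simp flip: T_def)
  next
    case (push y)
    then have y: "T ! Suc i = Sym y" using tn[of "Suc i"] lT by simp
    have "write_step M (q, label_word a @ u, take i T @ [T ! i], [Top])
        (p, u, take i T @ [T ! i, Sym y], [Top])"
      using u i lT tn[of i] push by (intro write_step.push tk) auto
    then show ?thesis using push i lT y sym[OF y]
      by (auto simp: step_def Ts simp flip: T_def)
  next
    case switch
    \<comment> \<open>\<open>switch\<close> corresponds to no step: at the topmost symbol both
      phases describe the same configuration.\<close>
    then have "i = length w" using top[of i] i tn[of "Suc i"] lT by (cases "i < length w") auto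
    then have "drop (Suc i) T = [Top]" by (simp add: T_def map_fst_tape)
    then show ?thesis using switch by (simp flip: T_def)
  next
    case down
    then have l: "Suc j < length T" using lT by simp
    have "T ! Suc j \<noteq> Bottom" using l by (auto simp: T_def map_fst_tape nth_append)
    then have "read_step M (q, label_word a @ u, take (Suc j) T @ [T ! Suc j], drop (Suc (Suc j)) T)
       (p, u, take (Suc j) T, T ! Suc j # drop (Suc (Suc j)) T)"
      using down u tn[OF l] T by (intro read_step.down) (auto simp: Td l)
    then show ?thesis using down l Ts[of "Suc j"]
      by (auto simp: step_def Cons_nth_drop_Suc simp flip: T_def)
  next
    case here
    then have l: "i < length T" using lT by simp
    have "read_step M (q, label_word a @ u, take i T @ [T ! i], drop (Suc i) T)
       (p, u, take i T @ [T ! i], drop (Suc i) T)"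
      using here u tn[OF l] T by (intro read_step.here) (auto simp: Td l)
    then show ?thesis using here l Ts[of i] by (auto simp: step_def simp flip: T_def)
  next
    case up
    then have l: "Suc i < length T" using lT by simp
    then have dr: "drop (Suc i) T = T ! Suc i # drop (Suc (Suc i)) T"
      by (simp add: Cons_nth_drop_Suc)
    have "take i T @ T ! i # T ! Suc i # drop (Suc (Suc i)) T \<in> stacks M"
      using Td[of i] l T dr by simp
    then have "read_step M (q, label_word a @ u, take i T @ [T ! i], T ! Suc i # drop (Suc (Suc i)) T)
       (p, u, take i T @ [T ! i, T ! Suc i], drop (Suc (Suc i)) T)"
      using up u tn[of i] l by (intro read_step.up) auto
    then show ?thesis using up l Ts[of i] Ts[of "Suc i"] dr
      by (auto simp: step_def simp flip: T_def)
  qed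
qed

lemma gpath_steps:
  assumes M: "stack_automaton M" and w: "w \<in> lists (work M \<times> UNIV)"
    and p: "gpath M (tape w) c xs e" and c: "\<not> fst c \<longrightarrow> snd (snd c) \<le> length w"
  shows "(step M)\<^sup>*\<^sup>* (node_config w c (path_word xs)) (node_config w e []) \<and>
    path_word xs \<in> lists (inputs M)"
  using p c
proof induction
  case (nil c)
  then show ?case by simp
next
  case (cons a c d xs e)
  obtain h q i where c: "c = (h, q, i)" by (cases c) auto
  obtain h' q' i' where d: "d = (h', q', i')" by (cases d) auto
  have e: "gedge M (tape w) a (h, q, i) (h', q', i')" using cons c d by simp
  have a: "label_word a \<in> lists (inputs M)"
    using e by cases (cases a, auto dest!: trans_rel_wf[OF M] simp: input_labels_def)+
  have *: "\<not> h' \<longrightarrow> i' \<le> length w" using gedge_steps[OF M w _ e, of "[]"] cons.prems c by auto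
  then have IH: "(step M)\<^sup>*\<^sup>* (node_config w d (path_word xs)) (node_config w e [])"
    "path_word xs \<in> lists (inputs M)" using cons.IH d by auto
  have "(step M)\<^sup>*\<^sup>* (node_config w c (label_word a @ path_word xs)) (node_config w d (path_word xs))"
    using gedge_steps[OF M w IH(2) e] cons.prems c d by auto
  then show ?case using IH a by auto
qed

text \<open>The input is the label word of a loop-free walk, which the simulated computation
  consumes completely. This makes it suitable for both measures.\<close>

lemma attains_if_accepts:
  assumes M: "stack_automaton M" and w: "accepts M (target_states z M) w"
  obtains u where "u \<in> lists (inputs M)" "attains z M u (length w)"
    "length u \<le> 2 * card (states M) * (loud_count w + 2)"
proof -
  obtain q i where q: "q \<in> target_states z M" "reach M (tape w) (False, start M, 0) (True, q, i)"
    using w by (auto simp: accepts_def accepts_tape_def)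
  obtain xs where xs: "gpath M (tape w) (False, start M, 0) xs (True, q, i)" "distinct (map fst xs)"
    using distinct_gpath[OF q(2)] .
  have st: "(step M)\<^sup>*\<^sup>* (node_config w (False, start M, 0) (path_word xs)) (node_config w (True, q, i) [])"
    "path_word xs \<in> lists (inputs M)"
    using gpath_steps[OF M _ xs(1)] w by (auto simp: accepts_def)
  have "attains z M (path_word xs) (length w)"
    unfolding attains_def
    by (rule exI[of _ "node_config w (True, q, i) []"])
      (use st(1) q(1) in \<open>auto simp: map_fst_tape\<close>)
  then show ?thesis using that st(2) length_path_word[OF M xs] by blast
qed

section \<open>The trichotomy\<close>

definition quiet_block where
  "quiet_block M F k \<longleftrightarrow>
    (\<exists>w y z. accepts M F (w @ y @ z) \<and> length y = k \<and> (\<forall>x \<in> set y. snd x))"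

definition long_word where
  "long_word M F k \<longleftrightarrow> (\<exists>w. accepts M F w \<and> k \<le> length w)"

lemma long_word_if_quiet_block: "quiet_block M F k \<Longrightarrow> long_word M F k"
  unfolding quiet_block_def long_word_def by fastforce

text \<open>Cut the word into consecutive blocks of length \<open>k\<close>: each full block
  contains a loud letter, and only the last block may be shorter.\<close>

lemma length_le_if_no_block:
  assumes "\<not> (\<exists>a y b. w = a @ y @ b \<and> length y = k \<and> (\<forall>x \<in> set y. snd x))" "0 < k"
  shows "length w \<le> k * (loud_count w + 1)"
  using assms(1)
proof (induction w rule: length_induct)
  case (1 w)
  show ?case
  proof (cases "length w \<le> k")
    case False
    let ?y = "take k w" and ?b = "drop k w"
    have len: "length ?y = k" using False by simp
    have "\<not> (\<exists>a y b. ?b = a @ y @ b \<and> length y = k \<and> (\<forall>x \<in> set y. snd x))"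
    proof
      assume "\<exists>a y b. ?b = a @ y @ b \<and> length y = k \<and> (\<forall>x \<in> set y. snd x)"
      then obtain a y b where *: "?b = a @ y @ b" "length y = k" "\<forall>x \<in> set y. snd x" by blast
      have "w = (?y @ a) @ y @ b" using * by (metis append.assoc append_take_drop_id)
      then show False using 1(2) * by blast
    qed
    moreover have "length ?b < length w" using assms(2) False by simp
    ultimately have IH: "length ?b \<le> k * (loud_count ?b + 1)" using 1(1) by blast
    have "\<exists>x \<in> set ?y. \<not> snd x" using 1(2) len append_take_drop_id[of k w]
      by (metis append_Nil)
    then have "1 \<le> loud_count ?y" by (auto simp: Suc_le_eq filter_empty_conv)
    moreover have "loud_count w = loud_count ?y + loud_count ?b"
      by (metis append_take_drop_id filter_append length_append)
    ultimately have "k * (loud_count ?b + 2) \<le> k * (loud_count w + 1)" by (intro mult_le_mono2) simp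
    then show ?thesis using IH False by (simp add: algebra_simps)
  qed (auto intro: trans_le_add1)
qed

lemma class_bound_pos: "0 < class_bound n"
  by (simp add: class_bound_def)

section \<open>The three cases in terms of quiet blocks and long words\<close>

text \<open>The bound \<open>n\<close> is left open because it is instantiated twice: with exact
  cardinalities for the trichotomy, and with the code of the automaton for decidability.\<close>

locale csa =
  fixes M :: "('q, 'a, 'g) sa" and z :: space_kind and n :: nat
  assumes csa: "checking_stack_automaton M"
    and states_le: "card (states M) \<le> n" and work_le: "card (work M) \<le> n"
begin

abbreviation "K \<equiv> class_bound n"
abbreviation "C \<equiv> 2 * card (states M)"
abbreviation "Acc \<equiv> accepts M (target_states z M)"

lemma sa: "stack_automaton M" and ne: "non_erasing M"
  using csa by (auto simp: checking_stack_automaton_def)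

lemma C_pos: "0 < C"
  using sa by (auto simp: stack_automaton_def card_gt_0_iff)

lemma attains_le: "u \<in> lists (inputs M) \<Longrightarrow> attains z M u m \<Longrightarrow> enat m \<le> word_space z M u"
  unfolding word_space_eq[OF ne] by (rule SUP_upper) simp

lemma word_space_le:
  "u \<in> lists (inputs M) \<Longrightarrow> (\<And>m. attains z M u m \<Longrightarrow> m \<le> b) \<Longrightarrow> word_space z M u \<le> enat b"
  unfolding word_space_eq[OF ne] by (rule SUP_least) simp

lemma unlimited_if_quiet_block:
  assumes "quiet_block M (target_states z M) K"
  shows "unlimited z M"
proof (rule ccontr)
  assume lim: "\<not> unlimited z M"
  obtain w y v where acc: "Acc (w @ y @ v)" and y: "length y = K" "\<forall>x \<in> set y. snd x"
    using assms unfolding quiet_block_def by blast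
  \<comment> \<open>Pumping a quiet block adds no loud cells, so this bound on the input length does
    not depend on how far the block is pumped.\<close>
  let ?B = "C * (length w + length v + 2)"
  let ?U = "{u. set u \<subseteq> inputs M \<and> length u \<le> ?B}"
  have fin: "finite ?U" using sa by (intro finite_lists_length_le) (simp add: stack_automaton_def)
  define N where "N = Max (insert 0 ((\<lambda>u. the_enat (word_space z M u)) ` ?U))"
  obtain y' where y': "set y' \<subseteq> set y" "Suc N \<le> length y'" "Acc (w @ y' @ v)"
    using pump_up[OF sa states_le work_le acc] y(1) by (metis order_refl)
  obtain u where u: "u \<in> lists (inputs M)" "attains z M u (length (w @ y' @ v))"
    "length u \<le> C * (loud_count (w @ y' @ v) + 2)"
    using attains_if_accepts[OF sa y'(3)] .
  have "loud_count y' = 0" using y' y(2) by (auto simp: filter_empty_conv)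
  then have "loud_count (w @ y' @ v) \<le> length w + length v"
    by (simp add: add_mono)
  then have "length u \<le> ?B" using u(3) by (meson add_le_mono1 le_trans mult_le_mono2)
  then have "u \<in> ?U" using u(1) by auto
  then have "the_enat (word_space z M u) \<le> N" unfolding N_def using fin by (intro Max_ge) auto
  moreover have "word_space z M u \<noteq> \<infinity>" using lim u(1) by (auto simp: unlimited_def)
  ultimately have "word_space z M u \<le> enat N" by (cases "word_space z M u") auto
  moreover have "enat (length (w @ y' @ v)) \<le> word_space z M u" using attains_le u by blast
  ultimately have "length (w @ y' @ v) \<le> N" by (meson enat_ord_simps(1) order_trans)
  then show False using y'(2) by simp
qed

lemma word_space_linear:
  assumes "\<not> quiet_block M (target_states z M) K" "u \<in> lists (inputs M)"
  shows "word_space z M u \<le> enat (K * (length u + 1))"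
proof (rule word_space_le[OF assms(2)])
  fix m assume "attains z M u m"
  then obtain w where w: "Acc w" "length w = m" "loud_count w \<le> length u"
    using accepts_if_attains[OF csa] by blast
  have "length w \<le> K * (loud_count w + 1)"
    using assms(1) w(1) by (intro length_le_if_no_block class_bound_pos) (auto simp: quiet_block_def)
  also have "\<dots> \<le> K * (length u + 1)" using w(3) by (intro mult_le_mono2) simp
  finally show "m \<le> K * (length u + 1)" using w(2) by simp
qed

lemma limited_if_no_quiet_block:
  assumes "\<not> quiet_block M (target_states z M) K"
  shows "limited z M"
  using word_space_linear[OF assms] unfolding unlimited_def by force

lemma unlimited_iff: "unlimited z M \<longleftrightarrow> quiet_block M (target_states z M) K"
  using unlimited_if_quiet_block limited_if_no_quiet_block by blast

lemma space_linear:
  assumes "\<not> quiet_block M (target_states z M) K"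
  shows "space z M k \<le> enat (K * (k + 1))" "space_upto z M k \<le> enat (K * (k + 1))"
proof -
  have *: "word_space z M u \<le> enat (K * (k + 1))" if "u \<in> lists (inputs M)" "length u \<le> k" for u
  proof -
    have "enat (K * (length u + 1)) \<le> enat (K * (k + 1))"
      using that(2) by (simp del: mult_Suc_right)
    then show ?thesis using word_space_linear[OF assms that(1)] by (rule order_trans[rotated])
  qed
  show "space z M k \<le> enat (K * (k + 1))" "space_upto z M k \<le> enat (K * (k + 1))"
    unfolding space_def space_upto_def by (rule SUP_least; use * in auto)+
qed

lemma constant_if_no_long_word:
  assumes "\<not> long_word M (target_states z M) K"
  shows "constant_space z M"
proof -
  have w: "word_space z M u \<le> enat K" if "u \<in> lists (inputs M)" for u
  proof (rule word_space_le[OF that])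
    fix m assume "attains z M u m"
    then show "m \<le> K" using accepts_if_attains[OF csa] assms
      unfolding long_word_def by (metis linear)
  qed
  then have "space z M k \<le> enat K" for k unfolding space_def by (intro SUP_least) auto
  then have "the_enat (space z M k) \<le> K" for k
    by (metis enat_ile enat_ord_simps(1) the_enat.simps)
  then have "(\<lambda>k. real_of_enat (space z M k)) \<in> O(\<lambda>k. 1)"
    by (intro bigoI[where c = "real K"]) simp
  then show ?thesis
    using limited_if_no_quiet_block assms long_word_if_quiet_block
    unfolding constant_space_def by blast
qed

text \<open>Take a shortest accepted word of length at least \<open>N\<close>. Beyond
  \<open>N + K\<close>, pumping down would give a shorter one that is still long enough. Its loud
  cells are bounded by its length, which keeps the input linear in \<open>N\<close>.\<close>

lemma dense_lengths:
  assumes "long_word M (target_states z M) K"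
  obtains u m where "u \<in> lists (inputs M)" "attains z M u m" "N \<le> m" "length u \<le> C * (N + K + 2)"
proof -
  obtain w0 where w0: "Acc w0" "K \<le> length w0" using assms unfolding long_word_def by blast
  then have "Acc ([] @ w0 @ [])" by simp
  from pump_up[OF sa states_le work_le this w0(2), of N]
  have "\<exists>w. Acc w \<and> N \<le> length w" by auto
  then obtain w where w: "Acc w" "N \<le> length w"
    and least: "\<And>v. Acc v \<Longrightarrow> N \<le> length v \<Longrightarrow> length w \<le> length v"
    using ex_has_least_nat[of "\<lambda>w. Acc w \<and> N \<le> length w" _ length] by blast
  have "length w \<le> N + K"
  proof (rule ccontr)
    assume l: "\<not> length w \<le> N + K"
    then have k: "K \<le> length w" by simp
    have "Acc ([] @ w @ [])" using w by simp
    from pump_down[OF sa states_le work_le this k] obtain v where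
      "length v < length w" "length w \<le> length v + K" "Acc v" by auto
    then show False using least[of v] l by simp
  qed
  moreover obtain u where u: "u \<in> lists (inputs M)" "attains z M u (length w)"
    "length u \<le> C * (loud_count w + 2)"
    using attains_if_accepts[OF sa w(1)] .
  moreover have "loud_count w \<le> length w" by simp
  ultimately have "C * (loud_count w + 2) \<le> C * (N + K + 2)" by (intro mult_le_mono2) linarith
  then show ?thesis using that[OF u(1,2) w(2)] u(3) by linarith
qed

lemma linear_if_long_word:
  assumes nb: "\<not> quiet_block M (target_states z M) K"
    and lw: "long_word M (target_states z M) K"
  shows "linear_space z M"
proof -
  define f where "f k = the_enat (space z M k)" for k
  define g where "g k = the_enat (space_upto z M k)" for k
  have fin: "space z M k = enat (f k)" "space_upto z M k = enat (g k)" for k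
    using space_linear[OF nb, of k] unfolding f_def g_def
    by (metis enat_ile the_enat.simps)+
  have ub: "f k \<le> K * (k + 1)" "g k \<le> K * (k + 1)" for k
    using space_linear[OF nb, of k] unfolding fin by simp_all
  \<comment> \<open>Here \<open>l\<close> is the length of one suitable input. \<open>f\<close> need
    not be monotone, so it is bounded below only at \<open>l\<close>, whereas the bound on
    \<open>g\<close> persists for all larger arguments.\<close>
  have lb: "\<exists>l. l \<le> C * (N + K + 2) \<and> N \<le> f l \<and> (\<forall>k \<ge> l. N \<le> g k)" for N
  proof -
    obtain u m where u: "u \<in> lists (inputs M)" "attains z M u m" "N \<le> m" "length u \<le> C * (N + K + 2)"
      using dense_lengths[OF lw] .
    have ws: "enat N \<le> word_space z M u" using attains_le[OF u(1,2)] u(3)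
      by (meson enat_ord_simps(1) order_trans)
    have "word_space z M u \<le> space z M (length u)"
      unfolding space_def using u(1) by (intro SUP_upper) simp
    then have "enat N \<le> enat (f (length u))" using ws unfolding fin by (rule order_trans[rotated])
    moreover have "N \<le> g k" if "length u \<le> k" for k
    proof -
      have "word_space z M u \<le> space_upto z M k"
        unfolding space_upto_def using u(1) that by (intro SUP_upper) simp
      then have "enat N \<le> enat (g k)" using ws unfolding fin by (rule order_trans[rotated])
      then show ?thesis by simp
    qed
    ultimately show ?thesis using u(4) by auto
  qed
  have bigo: "(\<lambda>k. real (h k)) \<in> O(\<lambda>k. real k)" if "\<And>k. h k \<le> K * (k + 1)" for h :: "nat \<Rightarrow> nat"
  proof (rule bigoI[where c = "real (2 * K)"], rule eventually_sequentiallyI[of 1])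
    fix k :: nat assume "1 \<le> k"
    then have "K * (k + 1) \<le> 2 * K * k" by (simp add: algebra_simps)
    then have "h k \<le> 2 * K * k" using that[of k] by linarith
    then have "real (h k) \<le> real (2 * K * k)" by (rule of_nat_mono)
    then show "norm (real (h k)) \<le> real (2 * K) * norm (real k)" by simp
  qed
  have "(\<lambda>k. real (f k)) \<notin> o(\<lambda>k. real k)"
  proof
    assume "(\<lambda>k. real (f k)) \<in> o(\<lambda>k. real k)"
    \<comment> \<open>For \<open>N\<close> at least \<open>1\<close>, the bound
      \<open>C * (N + K + 2)\<close> on \<open>l\<close> is at most \<open>C * (K + 3) * N\<close>.
      This fixes the ratio that infinitely many lengths attain.\<close>
    moreover have "0 < 1 / real (C * (K + 3))" using C_pos by simp
    ultimately obtain k0 where k0: "\<And>k. k > k0 \<Longrightarrow> real (f k) < 1 / real (C * (K + 3)) * real k"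
      unfolding smallo_real_iff_strict by blast
    \<comment> \<open>This exceeds the upper bound for \<open>f\<close> on all arguments up to
      \<open>k0\<close>, which forces \<open>l\<close> beyond \<open>k0\<close>.\<close>
    let ?N = "K * (k0 + 1) + 1"
    obtain l where l: "l \<le> C * (?N + K + 2)" "?N \<le> f l" using lb by blast
    have "\<not> l \<le> k0"
    proof
      assume "l \<le> k0"
      then have "K * (l + 1) \<le> K * (k0 + 1)" by (intro mult_le_mono2) simp
      then show False using l(2) ub(1)[of l] by linarith
    qed
    then have "real (f l) < real l / real (C * (K + 3))" using k0[of l] by simp
    then have "real (f l) * real (C * (K + 3)) < real l"
      using C_pos by (simp add: pos_less_divide_eq)
    then have "real (f l * (C * (K + 3))) < real l" by (simp only: of_nat_mult)
    then have "f l * (C * (K + 3)) < l" by (simp only: of_nat_less_iff)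
    moreover have "?N * (C * (K + 3)) \<le> f l * (C * (K + 3))" using l(2) by (rule mult_le_mono1)
    moreover have "C * (?N + K + 2) \<le> C * (?N * (K + 3))" by (intro mult_le_mono2) (simp add: algebra_simps)
    then have "C * (?N + K + 2) \<le> ?N * (C * (K + 3))" by (metis mult.left_commute)
    ultimately show False using l(1) by linarith
  qed
  moreover have "(\<lambda>k. real (g k)) \<in> \<Omega>(\<lambda>k. real k)"
  proof (rule landau_omega.bigI[where c = "1 / real (2 * C)"])
    show "0 < 1 / real (2 * C)" using C_pos by simp
    show "\<forall>\<^sub>F k in at_top. 1 / real (2 * C) * norm (real k) \<le> norm (real (g k))"
    \<comment> \<open>From this threshold on, the additive loss \<open>C * (K + 3)\<close> is at
      most half of \<open>k\<close>, whence the factor \<open>2 * C\<close>.\<close>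
    proof (rule eventually_sequentiallyI[of "2 * (C * (K + 3))"])
      fix k assume k: "2 * (C * (K + 3)) \<le> k"
      \<comment> \<open>The largest \<open>N\<close> with \<open>C * (N + K + 2)\<close> at most
        \<open>k\<close>. The threshold ensures that the subtraction is not truncated.\<close>
      let ?N = "k div C - (K + 2)"
      have "C * (K + 3) \<le> k" using k by linarith
      then have "K + 3 \<le> k div C" using C_pos by (simp only: less_eq_div_iff_mult_less_eq mult.commute)
      then have N: "?N + K + 2 = k div C" by simp
      then have "C * (?N + K + 2) \<le> k" by (simp only: times_div_less_eq_dividend)
      then have "?N \<le> g k" using lb[of ?N] by (meson order_trans)
      then have "k div C + 1 \<le> g k + (K + 3)" using N by linarith
      then have "C * (k div C + 1) \<le> C * (g k + (K + 3))" by (rule mult_le_mono2)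
      moreover have "k < C * (k div C + 1)" using C_pos dividend_less_times_div[of C k] by simp
      ultimately have "k \<le> C * g k + C * (K + 3)" by (simp only: distrib_left)
      then have "k \<le> 2 * C * g k" using k by simp
      then have "real k \<le> real (2 * C * g k)" by (rule of_nat_mono)
      then have "real k \<le> real (2 * C) * real (g k)" by (simp only: of_nat_mult)
      then show "1 / real (2 * C) * norm (real k) \<le> norm (real (g k))"
        using C_pos by (simp add: divide_le_eq mult.commute)
    qed
  qed
  ultimately show ?thesis
    using bigo[of f, OF ub(1)] bigo[of g, OF ub(2)] limited_if_no_quiet_block[OF nb]
    unfolding linear_space_def f_def g_def by (auto intro: bigthetaI)
qed

text \<open>\<open>O(1)\<close> is contained in \<open>o(n)\<close>, which linear space rules
  out.\<close>

lemma constant_linear_exclusive: "\<not> (constant_space z M \<and> linear_space z M)"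
proof
  assume "constant_space z M \<and> linear_space z M"
  then have "(\<lambda>k. real_of_enat (space z M k)) \<in> O(\<lambda>k. 1)"
    "(\<lambda>k. real_of_enat (space z M k)) \<notin> o(\<lambda>k. real k)"
    by (auto simp: constant_space_def linear_space_def)
  moreover have "(\<lambda>k. 1 :: real) \<in> o(\<lambda>k. real k)"
    by (auto intro!: smalloI_tendsto tendsto_divide_0[OF tendsto_const]
        filterlim_at_top_imp_at_infinity filterlim_real_sequentially eventually_gt_at_top[THEN eventually_mono])
  ultimately show False by (blast intro: landau_o.big_small_trans)
qed

text \<open>The conditions on accepted words are exhaustive and the three cases exclude each other,
  so the implications shown so far can be reversed.\<close>

lemma linear_iff:
  "linear_space z M \<longleftrightarrow> \<not> quiet_block M (target_states z M) K \<and> long_word M (target_states z M) K"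
  using linear_if_long_word constant_if_no_long_word constant_linear_exclusive unlimited_iff
  unfolding linear_space_def by blast

lemma constant_iff: "constant_space z M \<longleftrightarrow> \<not> long_word M (target_states z M) K"
  using linear_if_long_word constant_if_no_long_word constant_linear_exclusive unlimited_iff
  unfolding constant_space_def by blast

end

section \<open>Closure properties of recursive functions\<close>

text \<open>Closes \<open>recursive\<close> under equality on lists of length \<open>k\<close>, so
  that ordinary terms can be treated without regard to their values on other lists.\<close>

definition recfun :: "nat \<Rightarrow> (nat list \<Rightarrow> nat) \<Rightarrow> bool" where
  "recfun k f \<longleftrightarrow> (\<exists>g. recursive k g \<and> (\<forall>xs. length xs = k \<longrightarrow> g xs = f xs))"

definition recpred :: "nat \<Rightarrow> (nat list \<Rightarrow> bool) \<Rightarrow> bool" where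
  "recpred k P \<longleftrightarrow> recfun k (\<lambda>e. of_bool (P e))"

lemma recfun_cong: "recfun k f \<Longrightarrow> (\<And>xs. length xs = k \<Longrightarrow> f xs = g xs) \<Longrightarrow> recfun k g"
  unfolding recfun_def by metis

lemma recfun_comp:
  assumes "recfun (length fs) g" "\<forall>f \<in> set fs. recfun k f"
  shows "recfun k (\<lambda>xs. g (map (\<lambda>f. f xs) fs))"
proof -
  obtain g' where g': "recursive (length fs) g'" "\<forall>xs. length xs = length fs \<longrightarrow> g' xs = g xs"
    using assms(1) unfolding recfun_def by blast
  obtain \<phi> where \<phi>: "\<forall>f\<in>set fs. recursive k (\<phi> f) \<and> (\<forall>xs. length xs = k \<longrightarrow> \<phi> f xs = f xs)"
    using assms(2) unfolding recfun_def by metis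
  have "recursive k (\<lambda>xs. g' (map (\<lambda>f. f xs) (map \<phi> fs)))"
    by (rule recursive.comp) (use g' \<phi> in auto)
  moreover have "g' (map (\<lambda>f. f xs) (map \<phi> fs)) = g (map (\<lambda>f. f xs) fs)" if "length xs = k" for xs
  proof -
    have "map (\<lambda>f. f xs) (map \<phi> fs) = map (\<lambda>f. f xs) fs" using \<phi> that by simp
    then show ?thesis using g' by (simp del: map_map)
  qed
  ultimately show ?thesis unfolding recfun_def by blast
qed

lemma recfun_proj: "i < k \<Longrightarrow> recfun k (\<lambda>xs. xs ! i)"
  unfolding recfun_def using recursive.proj by blast

text \<open>Argument lists act as de Bruijn contexts: a binder puts its variable at the head,
  \<open>hd\<close> is the innermost variable, and \<open>tl\<close> passes to the enclosing
  context.\<close>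

lemma recfun_hd: "recfun (Suc k) (\<lambda>e. hd e)"
  by (rule recfun_cong[OF recfun_proj[of 0]]) (auto simp: length_Suc_conv)

lemma recfun_tl:
  assumes "recfun k f"
  shows "recfun (Suc k) (\<lambda>e. f (tl e))"
proof -
  let ?fs = "map (\<lambda>i xs. xs ! Suc i) [0..<k]"
  have "recfun (Suc k) (\<lambda>xs. f (map (\<lambda>f. f xs) ?fs))"
    by (rule recfun_comp) (use assms recfun_proj in auto)
  then show ?thesis
  proof (rule recfun_cong)
    fix xs :: "nat list" assume "length xs = Suc k"
    then have "map (\<lambda>f. f xs) ?fs = tl xs" by (auto intro!: nth_equalityI simp: nth_tl)
    then show "f (map (\<lambda>f. f xs) ?fs) = f (tl xs)" by simp
  qed
qed

text \<open>Primitive recursion in context form: the recursion argument is any recursive function of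
  the context, and the body sees the counter and the previous value in front of it.\<close>

lemma recfun_rec_nat:
  assumes f: "recfun k f" and g: "recfun k g"
    and h: "recfun (Suc (Suc k)) (\<lambda>e. h (hd e) (hd (tl e)) (tl (tl e)))"
  shows "recfun k (\<lambda>e. rec_nat (g e) (\<lambda>n r. h n r e) (f e))"
proof -
  obtain g' where g': "recursive k g'" "\<forall>xs. length xs = k \<longrightarrow> g' xs = g xs"
    using g unfolding recfun_def by blast
  obtain h' where h': "recursive (Suc (Suc k)) h'"
    "\<forall>xs. length xs = Suc (Suc k) \<longrightarrow> h' xs = h (hd xs) (hd (tl xs)) (tl (tl xs))"
    using h unfolding recfun_def by blast
  let ?G = "\<lambda>xs. rec_nat (g' (tl xs)) (\<lambda>n r. h' (n # r # tl xs)) (hd xs)"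
  let ?fs = "f # map (\<lambda>i xs. xs ! i) [0..<k]"
  have "recursive (Suc k) ?G" by (rule recursive.prec[OF g'(1) h'(1)])
  then have G: "recfun (length ?fs) ?G" unfolding recfun_def by auto
  have "recfun k (\<lambda>xs. ?G (map (\<lambda>f. f xs) ?fs))"
    by (rule recfun_comp[OF G]) (use f recfun_proj in auto)
  then show ?thesis
  proof (rule recfun_cong)
    fix xs :: "nat list" assume l: "length xs = k"
    then have e: "map (\<lambda>f. f xs) ?fs = f xs # xs" by (auto intro!: nth_equalityI)
    have "rec_nat (g' xs) (\<lambda>n r. h' (n # r # xs)) m = rec_nat (g xs) (\<lambda>n r. h n r xs) m" for m
      by (induction m) (use l g' h' in auto)
    then show "?G (map (\<lambda>f. f xs) ?fs) = rec_nat (g xs) (\<lambda>n r. h n r xs) (f xs)"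
      unfolding e by simp
  qed
qed

lemma recfun_Suc: "recfun k f \<Longrightarrow> recfun k (\<lambda>e. Suc (f e))"
  using recfun_comp[of "[f]" "\<lambda>xs. Suc (hd xs)" k] recursive.succ
  unfolding recfun_def by fastforce

lemma recfun_const: "recfun k (\<lambda>e. c)"
proof (induction c)
  case 0 then show ?case unfolding recfun_def using recursive.zero by blast
next
  case (Suc c) then show ?case by (rule recfun_Suc)
qed

lemma recfun_add: assumes "recfun k f" "recfun k g" shows "recfun k (\<lambda>e. f e + g e)"
proof -
  have "rec_nat b (\<lambda>n r. Suc r) a = a + b" for a b by (induction a) auto
  moreover have "recfun k (\<lambda>e. rec_nat (g e) (\<lambda>n r. Suc r) (f e))"
    by (rule recfun_rec_nat assms recfun_Suc recfun_tl recfun_hd)+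
  ultimately show ?thesis by simp
qed

lemma recfun_mult: assumes "recfun k f" "recfun k g" shows "recfun k (\<lambda>e. f e * g e)"
proof -
  have "rec_nat 0 (\<lambda>n r. b + r) a = a * b" for a b by (induction a) auto
  moreover have "recfun k (\<lambda>e. rec_nat 0 (\<lambda>n r. g e + r) (f e))"
    by (rule recfun_rec_nat assms recfun_const recfun_add recfun_tl recfun_hd)+
  ultimately show ?thesis by simp
qed

lemma recfun_power: assumes "recfun k f" "recfun k g" shows "recfun k (\<lambda>e. f e ^ g e)"
proof -
  have "rec_nat 1 (\<lambda>n r. b * r) a = b ^ a" for a b :: nat by (induction a) auto
  moreover have "recfun k (\<lambda>e. rec_nat 1 (\<lambda>n r. f e * r) (g e))"
    by (rule recfun_rec_nat assms recfun_const recfun_mult recfun_tl recfun_hd)+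
  ultimately show ?thesis by simp
qed

lemma recfun_pred: assumes "recfun k f" shows "recfun k (\<lambda>e. f e - 1)"
proof -
  have "rec_nat 0 (\<lambda>n r. n) a = a - 1" for a by (induction a) auto
  moreover have "recfun k (\<lambda>e. rec_nat 0 (\<lambda>n r. n) (f e))"
    by (rule recfun_rec_nat assms recfun_const recfun_hd)+
  ultimately show ?thesis by simp
qed

lemma recfun_diff: assumes "recfun k f" "recfun k g" shows "recfun k (\<lambda>e. f e - g e)"
proof -
  have "rec_nat b (\<lambda>n r. r - 1) a = b - a" for a b :: nat by (induction a) auto
  moreover have "recfun k (\<lambda>e. rec_nat (f e) (\<lambda>n r. r - 1) (g e))"
    by (rule recfun_rec_nat assms recfun_const recfun_pred recfun_tl recfun_hd)+
  ultimately show ?thesis by simp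
qed

section \<open>Recursive predicates, conditionals and bounded quantifiers\<close>

lemma recpred_not: assumes "recpred k P" shows "recpred k (\<lambda>e. \<not> P e)"
proof -
  have "recfun k (\<lambda>e. 1 - of_bool (P e))"
    using assms unfolding recpred_def by (intro recfun_diff recfun_const)
  then show ?thesis unfolding recpred_def by (rule recfun_cong) auto
qed

lemma recpred_conj: assumes "recpred k P" "recpred k Q" shows "recpred k (\<lambda>e. P e \<and> Q e)"
proof -
  have "recfun k (\<lambda>e. of_bool (P e) * of_bool (Q e))"
    using assms unfolding recpred_def by (intro recfun_mult)
  then show ?thesis unfolding recpred_def by (rule recfun_cong) auto
qed

lemma recpred_disj: assumes "recpred k P" "recpred k Q" shows "recpred k (\<lambda>e. P e \<or> Q e)"
  using recpred_not[OF recpred_conj[OF recpred_not[OF assms(1)] recpred_not[OF assms(2)]]] by simp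

lemma recpred_imp: assumes "recpred k P" "recpred k Q" shows "recpred k (\<lambda>e. P e \<longrightarrow> Q e)"
  using recpred_disj[OF recpred_not[OF assms(1)] assms(2)] by (simp only: imp_conv_disj)

lemma recpred_le: assumes "recfun k f" "recfun k g" shows "recpred k (\<lambda>e. f e \<le> g e)"
proof -
  have "recfun k (\<lambda>e. 1 - (f e - g e))" using assms by (intro recfun_diff recfun_const)
  then show ?thesis unfolding recpred_def by (rule recfun_cong) auto
qed

lemma recpred_less: assumes "recfun k f" "recfun k g" shows "recpred k (\<lambda>e. f e < g e)"
  using recpred_le[OF recfun_Suc[OF assms(1)] assms(2)] by (simp add: Suc_le_eq)

lemma recpred_eq: assumes "recfun k f" "recfun k g" shows "recpred k (\<lambda>e. f e = g e)"
  using recpred_conj[OF recpred_le[OF assms] recpred_le[OF assms(2,1)]] by (simp only: order_eq_iff[symmetric])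

lemma recfun_if:
  assumes "recpred k P" "recfun k f" "recfun k g"
  shows "recfun k (\<lambda>e. if P e then f e else g e)"
proof -
  have "recfun k (\<lambda>e. of_bool (P e) * f e + (1 - of_bool (P e)) * g e)"
    using assms unfolding recpred_def by (intro recfun_add recfun_mult recfun_diff recfun_const)
  then show ?thesis by (rule recfun_cong) auto
qed

lemma recpred_tl: "recpred k P \<Longrightarrow> recpred (Suc k) (\<lambda>e. P (tl e))"
  unfolding recpred_def by (rule recfun_tl)

lemma recfun_mod: assumes "recfun k f" "recfun k g" shows "recfun k (\<lambda>e. f e mod g e)"
proof -
  \<comment> \<open>For \<open>b = 0\<close> the counter is never reset, as
    \<open>a mod 0 = a\<close> requires.\<close>
  have "rec_nat 0 (\<lambda>n r. if Suc r = b then 0 else Suc r) a = a mod b" for a b :: nat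
    by (induction a) (auto simp: mod_Suc)
  moreover have "recfun k (\<lambda>e. rec_nat 0 (\<lambda>n r. if Suc r = g e then 0 else Suc r) (f e))"
    by (rule recfun_rec_nat assms recfun_const recfun_if recpred_eq recfun_Suc recfun_tl recfun_hd)+
  ultimately show ?thesis by simp
qed

lemma recfun_div: assumes "recfun k f" "recfun k g" shows "recfun k (\<lambda>e. f e div g e)"
proof -
  \<comment> \<open>For \<open>b = 0\<close> the condition never holds, as
    \<open>a div 0 = 0\<close> requires.\<close>
  have "rec_nat 0 (\<lambda>n r. if Suc n mod b = 0 then Suc r else r) a = a div b" for a b :: nat
    by (induction a) (auto simp: div_Suc)
  moreover have "recfun k (\<lambda>e. rec_nat 0 (\<lambda>n r. if Suc n mod g e = 0 then Suc r else r) (f e))"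
    by (rule recfun_rec_nat assms recfun_const recfun_if recpred_eq recfun_Suc recfun_mod
        recfun_tl recfun_hd)+
  ultimately show ?thesis by simp
qed

lemma recpred_bex:
  assumes b: "recfun k b" and P: "recpred (Suc k) (\<lambda>e. P (hd e) (tl e))"
  shows "recpred k (\<lambda>e. \<exists>x<b e. P x e)"
proof -
  \<comment> \<open>The recursion puts its accumulator between the bound variable and the context,
    so \<open>P\<close> has to skip the second entry.\<close>
  have P': "recpred (Suc (Suc k)) (\<lambda>e. P (hd e) (tl (tl e)))"
  proof -
    let ?fs = "(\<lambda>xs. xs ! 0) # map (\<lambda>i xs. xs ! Suc (Suc i)) [0..<k]"
    have "recfun (Suc (Suc k)) (\<lambda>xs. (\<lambda>e. of_bool (P (hd e) (tl e))) (map (\<lambda>f. f xs) ?fs))"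
      by (rule recfun_comp) (use P recfun_proj in \<open>auto simp: recpred_def\<close>)
    then show ?thesis unfolding recpred_def
    proof (rule recfun_cong)
      fix xs :: "nat list" assume "length xs = Suc (Suc k)"
      then obtain x y ys where "xs = x # y # ys" "length ys = k"
        by (metis length_Suc_conv)
      moreover from this have "map (\<lambda>f. f xs) ?fs = x # ys" by (auto intro!: nth_equalityI)
      ultimately show "of_bool (P (hd (map (\<lambda>f. f xs) ?fs)) (tl (map (\<lambda>f. f xs) ?fs)))
          = of_bool (P (hd xs) (tl (tl xs)))" by simp
    qed
  qed
  have eq: "rec_nat 0 (\<lambda>n r. if P n e then 1 else r) a = of_bool (\<exists>x<a. P x e)" for a e
    by (induction a) (auto simp: less_Suc_eq)
  have "recfun k (\<lambda>e. rec_nat 0 (\<lambda>n r. if P n e then 1 else r) (b e))"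
    by (rule recfun_rec_nat b recfun_const recfun_if P' recfun_tl recfun_hd)+
  then show ?thesis unfolding recpred_def by (rule recfun_cong) (rule eq)
qed

lemma recpred_ball:
  assumes b: "recfun k b" and P: "recpred (Suc k) (\<lambda>e. P (hd e) (tl e))"
  shows "recpred k (\<lambda>e. \<forall>x<b e. P x e)"
  using recpred_not[OF recpred_bex[OF b recpred_not[OF P]]] by simp

lemma recpred_even: "recfun k f \<Longrightarrow> recpred k (\<lambda>e. even (f e))"
  unfolding even_iff_mod_2_eq_zero by (intro recpred_eq recfun_mod recfun_const)

text \<open>Together these rules read recursiveness off the shape of a formula, bounded quantifiers
  included.\<close>

lemmas rec_intros = recfun_hd recfun_tl recfun_const recfun_Suc recfun_add recfun_mult
  recfun_power recfun_diff recfun_div recfun_mod recfun_if recpred_tl recpred_eq recpred_le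
  recpred_less recpred_not recpred_conj recpred_disj recpred_imp recpred_bex recpred_ball
  recpred_even

lemma recfun_prod_encode:
  assumes "recfun k f" "recfun k g"
  shows "recfun k (\<lambda>e. prod_encode (f e, g e))"
proof -
  have "recfun k (\<lambda>e. (f e + g e) * Suc (f e + g e) div 2 + f e)"
    by (rule rec_intros assms)+
  then show ?thesis by (simp add: prod_encode_def triangle_def)
qed

lemma recpred_set_decode:
  assumes "recfun k f" "recfun k g"
  shows "recpred k (\<lambda>e. f e \<in> set_decode (g e))"
proof -
  have "recpred k (\<lambda>e. odd (g e div 2 ^ f e))"
    by (rule rec_intros assms)+
  then show ?thesis by (simp add: set_decode_def)
qed

lemma computable_if_recfun: assumes "recfun (Suc 0) (\<lambda>e. f (hd e))" shows "computable f"
proof -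
  obtain g where "recursive 1 g" "\<forall>xs. length xs = Suc 0 \<longrightarrow> g xs = f (hd xs)"
    using assms unfolding recfun_def by auto
  then show ?thesis unfolding computable_def by (intro exI[of _ g]) simp
qed

section \<open>Decidability by bounded search\<close>

context csa begin

text \<open>Minimise the total length of the two parts around the block. Either part could be pumped
  down if it had length \<open>K\<close> or more, so three pieces of length at most \<open>K\<close>
  remain.\<close>

lemma quiet_block_iff_short:
  "quiet_block M (target_states z M) K \<longleftrightarrow>
    (\<exists>w. Acc w \<and> length w \<le> 3 * K \<and> (\<exists>s. s + K \<le> length w \<and> (\<forall>i<K. snd (w ! (s + i)))))"
  (is "_ \<longleftrightarrow> ?R")
proof
  let ?P = "\<lambda>m. \<exists>w y v. Acc (w @ y @ v) \<and> length y = K \<and> (\<forall>x \<in> set y. snd x) \<and>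
    m = length w + length v"
  assume "quiet_block M (target_states z M) K"
  then have "\<exists>m. ?P m" unfolding quiet_block_def by blast
  then obtain m where "?P m" "\<forall>k<m. \<not> ?P k" using exists_least_iff[of ?P] by auto
  then obtain w y v where acc: "Acc (w @ y @ v)" and y: "length y = K" "\<forall>x \<in> set y. snd x"
    and least: "\<And>w' v'. Acc (w' @ y @ v') \<Longrightarrow> length w + length v \<le> length w' + length v'"
    by (metis not_less)
  have "length w < K"
  proof (rule ccontr)
    assume "\<not> length w < K"
    moreover have "Acc ([] @ w @ (y @ v))" using acc by simp
    ultimately obtain w' where "length w' < length w" "Acc ([] @ w' @ (y @ v))"
      using pump_down[OF sa states_le work_le] by (metis not_less)
    then show False using least[of w' v] by simp
  qed
  moreover have "length v < K"
  proof (rule ccontr)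
    assume "\<not> length v < K"
    moreover have "Acc ((w @ y) @ v @ [])" using acc by simp
    ultimately obtain v' where "length v' < length v" "Acc ((w @ y) @ v' @ [])"
      using pump_down[OF sa states_le work_le] by (metis not_less)
    then show False using least[of w v'] by simp
  qed
  moreover have "snd ((w @ y @ v) ! (length w + i))" if "i < K" for i
    using y that by (simp add: nth_append)
  ultimately show ?R using acc y(1)
    by (intro exI[of _ "w @ y @ v"] conjI exI[of _ "length w"]) auto
next
  assume ?R
  then obtain w s where w: "Acc w" "s + K \<le> length w" "\<forall>i<K. snd (w ! (s + i))" by blast
  have "w = take s w @ take K (drop s w) @ drop K (drop s w)" by (simp only: append_take_drop_id)
  moreover have "\<forall>x \<in> set (take K (drop s w)). snd x"
  proof
    fix x assume "x \<in> set (take K (drop s w))"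
    then obtain i where "i < K" "x = w ! (s + i)" using w(2) by (auto simp: in_set_conv_nth)
    then show "snd x" using w(3) by simp
  qed
  moreover have "length (take K (drop s w)) = K" using w(2) by simp
  ultimately show "quiet_block M (target_states z M) K"
    using w(1) unfolding quiet_block_def by metis
qed

text \<open>A shortest word of length at least \<open>K\<close> cannot exceed \<open>2 * K\<close>:
  pumping down removes at most \<open>K\<close> letters and would leave a shorter witness.\<close>

lemma long_word_iff_short:
  "long_word M (target_states z M) K \<longleftrightarrow> (\<exists>w. Acc w \<and> K \<le> length w \<and> length w \<le> 2 * K)"
proof
  assume "long_word M (target_states z M) K"
  then have "\<exists>w. Acc w \<and> K \<le> length w" unfolding long_word_def .
  then obtain w where w: "Acc w" "K \<le> length w"
    and least: "\<And>v. Acc v \<Longrightarrow> K \<le> length v \<Longrightarrow> length w \<le> length v"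
    using ex_has_least_nat[of "\<lambda>w. Acc w \<and> K \<le> length w" _ length] by blast
  have "length w \<le> 2 * K"
  proof (rule ccontr)
    assume l: "\<not> length w \<le> 2 * K"
    have "Acc ([] @ w @ [])" using w by simp
    from pump_down[OF sa states_le work_le this w(2)] obtain v where
      "length v < length w" "length w \<le> length v + K" "Acc v" by auto
    then show False using least[of v] l by simp
  qed
  then show "\<exists>w. Acc w \<and> K \<le> length w \<and> length w \<le> 2 * K" using w by blast
qed (auto simp: long_word_def)

end

section \<open>Arithmetical form of the search\<close>

text \<open>A tape is coded by its cells as digits in base \<open>b\<close>, lowest first. Reading a
  cell is then an arithmetical term, and the search over tapes of length \<open>l\<close> is a
  search below \<open>b ^ l\<close>.\<close>

definition digit :: "nat \<Rightarrow> nat \<Rightarrow> nat \<Rightarrow> nat" where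
  "digit b v i = v div b ^ i mod b"

lemma digits_exist:
  assumes "\<And>i. i < l \<Longrightarrow> f i < b"
  shows "\<exists>v < b ^ l. \<forall>i<l. digit b v i = f i"
  using assms
proof (induction l arbitrary: f)
  case (Suc l)
  have "\<exists>v<b ^ l. \<forall>i<l. digit b v i = f (Suc i)" using Suc.prems by (intro Suc.IH) auto
  then obtain v where v: "v < b ^ l" "\<And>i. i < l \<Longrightarrow> digit b v i = f (Suc i)" by blast
  have f: "f 0 < b" using Suc.prems by simp
  have "f 0 + b * v < b + b * v" using f by simp
  also have "\<dots> \<le> b * b ^ l" using v(1) by (metis Suc_leI mult_Suc_right mult_le_mono2)
  finally have "f 0 + b * v < b ^ Suc l" by simp
  moreover have "digit b (f 0 + b * v) i = f i" if "i < Suc l" for i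
  proof (cases i)
    case 0
    then show ?thesis using f by (simp add: digit_def)
  next
    case (Suc j)
    have "(f 0 + b * v) div b = v" using f by simp
    then have "(f 0 + b * v) div b ^ Suc j = v div b ^ j" by (simp add: div_mult2_eq)
    then show ?thesis using v(2)[of j] that Suc by (simp add: digit_def)
  qed
  ultimately show ?case by blast
qed auto

text \<open>The variable \<open>a\<close> ranges over label codes, where \<open>0\<close> is the
  empty label; an odd digit is a quiet cell.\<close>

definition scan_trans where
  "scan_trans n T b v q i p c \<longleftrightarrow> (\<exists>a<n. (odd (digit b v i) \<longrightarrow> a = 0) \<and>
     list_encode [q, a, digit b v i div 2, p, c] \<in> set_decode T)"

text \<open>
  Tape cells are digits \<open>2 * symbol + flag\<close>, and the last two triples of arguments are the phase, state
  and position of the source and the target, in the coding of \<^const>\<open>gedge\<close>.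
\<close>

definition num_edge where
  "num_edge n S T b v l h q i h' p j \<longleftrightarrow>
     h = 0 \<and> h' = 0 \<and> j = i \<and> i < l \<and> scan_trans n T b v q i p 0 \<or>
     h = 0 \<and> h' = 0 \<and> j = Suc i \<and> Suc i < l \<and>
       (\<exists>y<n. scan_trans n T b v q i p (y + 5) \<and> digit b v (Suc i) div 2 = y + 2) \<or>
     h = 0 \<and> h' = 1 \<and> p = q \<and> j = i \<and> Suc i < l \<and> digit b v (Suc i) div 2 = 1 \<and> q \<in> set_decode S \<or>
     h = 1 \<and> h' = 1 \<and> i = Suc j \<and> i < l \<and> scan_trans n T b v q i p 2 \<or>
     h = 1 \<and> h' = 1 \<and> j = i \<and> i < l \<and> scan_trans n T b v q i p 3 \<or>
     h = 1 \<and> h' = 1 \<and> j = Suc i \<and> Suc i < l \<and> scan_trans n T b v q i p 4"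

text \<open>Pairing is monotone in each argument, so \<open>node_code 1 n l\<close> bounds the codes
  of all nodes with states up to \<open>n\<close> and positions up to \<open>l\<close>.\<close>

definition node_code :: "nat \<Rightarrow> nat \<Rightarrow> nat \<Rightarrow> nat" where
  "node_code h q i = prod_encode (h, prod_encode (q, i))"

text \<open>
  Reachability as membership in all edge-closed sets \<open>X\<close>, where a bound on the codes of the nodes
  bounds the quantifier over \<open>X\<close>.
\<close>

definition num_accepts where
  "num_accepts n S T q0 F b v l \<longleftrightarrow> (\<forall>X < 2 ^ Suc (node_code 1 n l).
     node_code 0 q0 0 \<in> set_decode X \<and>
     (\<forall>h<2. \<forall>q<n. \<forall>i<l. \<forall>h'<2. \<forall>p<n. \<forall>j<l.
        num_edge n S T b v l h q i h' p j \<and> node_code h q i \<in> set_decode X \<longrightarrow>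
        node_code h' p j \<in> set_decode X) \<longrightarrow>
     (\<exists>q<n. \<exists>i<l. q \<in> set_decode F \<and> node_code 1 q i \<in> set_decode X))"

text \<open>The digits \<open>0\<close> and \<open>2\<close> are the two markers with cleared flag;
  \<open>Sym x\<close> has the halved digit \<open>x + 2\<close>.\<close>

definition num_tape where
  "num_tape W b v l \<longleftrightarrow> 2 \<le> l \<and> digit b v 0 = 0 \<and> digit b v (l - 1) = 2 \<and>
     (\<forall>i<l - 2. 2 \<le> digit b v (Suc i) div 2 \<and> digit b v (Suc i) div 2 - 2 \<in> set_decode W)"

text \<open>Work symbols are below the code \<open>n\<close>, so cell codes are at most
  \<open>2 * (n + 1) + 1\<close> and fit into base \<open>2 * n + 6\<close>.\<close>

definition num_word where
  "num_word n S W T q0 F v l \<longleftrightarrow>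
     num_tape W (2 * n + 6) v l \<and> num_accepts n S T q0 F (2 * n + 6) v l"

text \<open>The components are found by search below the code instead of by projection, so only
  encoding has to be recursive. \<open>l\<close> counts the markers too, which turns the word length
  bound \<open>3 * class_bound n\<close> into \<open>l < 3 * class_bound n + 3\<close>.\<close>

definition code_quiet_block :: "space_kind \<Rightarrow> nat \<Rightarrow> bool" where
  "code_quiet_block z n \<longleftrightarrow> (\<exists>S<n. \<exists>I<n. \<exists>W<n. \<exists>T<n. \<exists>q<n. \<exists>F<n.
     n = list_encode [S, I, W, T, q, F] \<and>
     (\<exists>l<3 * class_bound n + 3. \<exists>v<(2 * n + 6) ^ l.
        num_word n S W T q (if z = Accept then F else S) v l \<and>
        (\<exists>s<l. \<forall>i<class_bound n. s + i < l \<and> odd (digit (2 * n + 6) v (s + i)))))"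

definition code_long_word :: "space_kind \<Rightarrow> nat \<Rightarrow> bool" where
  "code_long_word z n \<longleftrightarrow> (\<exists>S<n. \<exists>I<n. \<exists>W<n. \<exists>T<n. \<exists>q<n. \<exists>F<n.
     n = list_encode [S, I, W, T, q, F] \<and>
     (\<exists>l<2 * class_bound n + 3. \<exists>v<(2 * n + 6) ^ l.
        num_word n S W T q (if z = Accept then F else S) v l \<and> class_bound n + 2 \<le> l))"

section \<open>Recursiveness of the search\<close>

lemmas rec_encode_intros = rec_intros recfun_prod_encode recpred_set_decode

lemma recfun_digit:
  assumes "recfun k b" "recfun k v" "recfun k i"
  shows "recfun k (\<lambda>e. digit (b e) (v e) (i e))"
  unfolding digit_def by (rule rec_intros assms)+

lemma recpred_scan_trans:
  assumes "recfun k n" "recfun k T" "recfun k b" "recfun k v" "recfun k q" "recfun k i"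
    "recfun k p" "recfun k c"
  shows "recpred k (\<lambda>e. scan_trans (n e) (T e) (b e) (v e) (q e) (i e) (p e) (c e))"
  unfolding scan_trans_def list_encode.simps
  by (rule assms recfun_digit rec_encode_intros)+

lemma recpred_num_edge:
  assumes "recfun k n" "recfun k S" "recfun k T" "recfun k b" "recfun k v" "recfun k l"
    "recfun k h" "recfun k q" "recfun k i" "recfun k h'" "recfun k p" "recfun k j"
  shows "recpred k (\<lambda>e. num_edge (n e) (S e) (T e) (b e) (v e) (l e)
    (h e) (q e) (i e) (h' e) (p e) (j e))"
  unfolding num_edge_def
  by (rule assms recfun_digit recpred_scan_trans rec_encode_intros)+

lemma recfun_node_code:
  assumes "recfun k h" "recfun k q" "recfun k i"
  shows "recfun k (\<lambda>e. node_code (h e) (q e) (i e))"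
  unfolding node_code_def by (rule assms rec_encode_intros)+

lemma recpred_num_accepts:
  assumes "recfun k n" "recfun k S" "recfun k T" "recfun k q0" "recfun k F"
    "recfun k b" "recfun k v" "recfun k l"
  shows "recpred k (\<lambda>e. num_accepts (n e) (S e) (T e) (q0 e) (F e) (b e) (v e) (l e))"
  unfolding num_accepts_def
  by (rule assms recfun_node_code recpred_num_edge rec_encode_intros)+

lemma recpred_num_tape:
  assumes "recfun k W" "recfun k b" "recfun k v" "recfun k l"
  shows "recpred k (\<lambda>e. num_tape (W e) (b e) (v e) (l e))"
  unfolding num_tape_def
  by (rule assms recfun_digit rec_encode_intros)+

lemma recpred_num_word:
  assumes "recfun k n" "recfun k S" "recfun k W" "recfun k T" "recfun k q0" "recfun k F"
    "recfun k v" "recfun k l"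
  shows "recpred k (\<lambda>e. num_word (n e) (S e) (W e) (T e) (q0 e) (F e) (v e) (l e))"
  unfolding num_word_def
  by (rule assms recpred_num_accepts recpred_num_tape rec_intros)+

lemma recfun_class_bound: "recfun k n \<Longrightarrow> recfun k (\<lambda>e. class_bound (n e))"
  unfolding class_bound_def by (rule rec_intros | assumption)+

text \<open>\<open>z\<close> is not a numerical argument; each of its two values gives a recursive
  predicate of its own.\<close>

lemma recpred_code_quiet_block: "recpred (Suc 0) (\<lambda>e. code_quiet_block z (hd e))"
  unfolding code_quiet_block_def list_encode.simps
  by (cases z; simp only: simp_thms space_kind.distinct if_True if_False)
    (rule recfun_class_bound recpred_num_word recfun_digit rec_encode_intros)+

lemma recpred_code_long_word: "recpred (Suc 0) (\<lambda>e. code_long_word z (hd e))"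
  unfolding code_long_word_def list_encode.simps
  by (cases z; simp only: simp_thms space_kind.distinct if_True if_False)
    (rule recfun_class_bound recpred_num_word recfun_digit rec_encode_intros)+

section \<open>Bounds and injectivity of codes\<close>

lemma list_encode_bound: "x \<in> set xs \<Longrightarrow> x < list_encode xs"
proof (induction xs)
  case (Cons y xs)
  have "y \<le> prod_encode (y, list_encode xs)" "list_encode xs \<le> prod_encode (y, list_encode xs)"
    by (rule le_prod_encode_1 le_prod_encode_2)+
  then show ?case using Cons by auto
qed simp

lemma set_decode_bound: assumes "x \<in> set_decode T" shows "x < T"
proof (rule ccontr)
  assume "\<not> x < T"
  then have "T < 2 ^ x" using less_exp[of x] by linarith
  then show False using assms by (simp add: set_decode_def)
qed

lemma triangle_mono: "m \<le> n \<Longrightarrow> triangle m \<le> triangle n"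
  unfolding triangle_def by (intro div_le_mono mult_le_mono) auto

lemma prod_encode_mono: "a \<le> a' \<Longrightarrow> b \<le> b' \<Longrightarrow> prod_encode (a, b) \<le> prod_encode (a', b')"
  unfolding prod_encode_def prod.case by (intro add_mono triangle_mono)

lemma set_encode_bound:
  assumes "A \<subseteq> {..<B}"
  shows "set_encode A < 2 ^ B"
proof -
  have "set_encode A \<le> set_encode {..<B}"
    unfolding set_encode_def using assms by (intro sum_mono2) auto
  also have "\<dots> < 2 ^ B"
    by (induction B) (simp_all add: set_encode_def lessThan_Suc)
  finally show ?thesis .
qed

lemma inj_label_code: "label_code a = label_code b \<longleftrightarrow> a = b"
  by (cases a; cases b) auto

lemma inj_stack_sym_code: "stack_sym_code a = stack_sym_code b \<longleftrightarrow> a = b"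
  by (cases a; cases b) auto

lemma inj_instr_code: "instr_code a = instr_code b \<longleftrightarrow> a = b"
  by (cases a; cases b) auto

lemma trans_code_inject: "trans_code c = trans_code d \<longleftrightarrow> c = d"
  by (cases c; cases d)
    (auto simp: list_encode_eq inj_label_code inj_stack_sym_code inj_instr_code simp del: list_encode.simps)

lemma finite_trans_rel:
  assumes "stack_automaton M"
  shows "finite (trans_rel M)"
proof (rule finite_subset)
  show "trans_rel M \<subseteq> states M \<times> input_labels M \<times> stack_alphabet M \<times> states M \<times> instrs M"
    using assms unfolding trans_rel_def stack_automaton_def by fast
  show "finite (states M \<times> input_labels M \<times> stack_alphabet M \<times> states M \<times> instrs M)"
    using assms by (simp add: stack_automaton_def input_labels_def stack_alphabet_def instrs_def)
qed

definition tape_digits :: "nat \<Rightarrow> nat \<Rightarrow> (nat stack_sym \<times> bool) list \<Rightarrow> bool" where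
  "tape_digits b v t \<longleftrightarrow>
    (\<forall>i<length t. digit b v i = 2 * stack_sym_code (fst (t ! i)) + of_bool (snd (t ! i)))"

section \<open>Agreement of the coded notions with the actual ones\<close>

locale coded_csa =
  fixes M :: "(nat, nat, nat) sa"
  assumes csa: "checking_stack_automaton M"
begin

abbreviation "N \<equiv> sa_code M"
abbreviation "S \<equiv> set_encode (states M)"
abbreviation "T \<equiv> set_encode (trans_code ` trans_rel M)"
abbreviation "W \<equiv> set_encode (work M)"

lemma sa: "stack_automaton M"
  using csa by (simp add: checking_stack_automaton_def)

lemma code_components: "S < N" "set_encode (inputs M) < N" "W < N" "T < N" "start M < N"
  "set_encode (final M) < N"
  unfolding sa_code_def by (rule list_encode_bound; simp)+

lemma finite_components [simp]: "finite (states M)" "finite (work M)" "finite (inputs M)"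
  "finite (final M)" "finite (trans_rel M)"
  using sa finite_trans_rel[OF sa] finite_subset[of "final M" "states M"]
  by (auto simp: stack_automaton_def)

lemma state_bound: "q \<in> states M \<Longrightarrow> q < N"
  using set_decode_bound[of q S] code_components(1) by simp

lemma work_bound: "x \<in> work M \<Longrightarrow> x < N"
  using set_decode_bound[of x W] code_components(3) by simp

text \<open>An entry is below the code of its transition, which is below \<open>T\<close>, which is
  below the code of the automaton. This justifies the quantifier bounds in \<open>scan_trans\<close>
  and \<open>num_edge\<close>.\<close>

lemma trans_bound:
  assumes "(q, a, x, p, c) \<in> trans_rel M"
  shows "label_code a < N" "instr_code c < N"
proof -
  have "trans_code (q, a, x, p, c) \<in> set_decode T"
    using imageI[OF assms, of trans_code]
    by (simp only: set_encode_inverse finite_imageI finite_components)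
  from set_decode_bound[OF this] code_components(4)
  have "list_encode [q, label_code a, stack_sym_code x, p, instr_code c] < N" by simp
  then show "label_code a < N" "instr_code c < N"
    by (rule less_trans[OF list_encode_bound, rotated]; simp)+
qed

lemma scan_trans_iff:
  assumes "tape_digits b v t" "i < length t"
  shows "scan_trans N T b v q i p (instr_code c) \<longleftrightarrow>
    (\<exists>a. (snd (t ! i) \<longrightarrow> a = None) \<and> (q, a, fst (t ! i), p, c) \<in> trans_rel M)"
proof -
  have d: "digit b v i div 2 = stack_sym_code (fst (t ! i))" "odd (digit b v i) \<longleftrightarrow> snd (t ! i)"
    using assms by (auto simp: tape_digits_def)
  have t: "list_encode [q, label_code a, digit b v i div 2, p, instr_code c] \<in> set_decode T \<longleftrightarrow>
    (q, a, fst (t ! i), p, c) \<in> trans_rel M" for a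
  proof -
    have "list_encode [q, label_code a, digit b v i div 2, p, instr_code c] =
      trans_code (q, a, fst (t ! i), p, c)" by (simp add: d)
    then show ?thesis by (simp only: set_encode_inverse finite_imageI finite_components
        inj_image_mem_iff[OF injI[OF trans_code_inject[THEN iffD1]]])
  qed
  have lab: "\<exists>a. a' = label_code a" for a'
    by (cases a') (auto intro: exI[of _ None] exI[of _ "Some x" for x])
  have lab0: "label_code a = 0 \<longleftrightarrow> a = None" for a by (cases a) auto
  show ?thesis unfolding scan_trans_def d(2)
  proof
    assume "\<exists>a<N. (snd (t ! i) \<longrightarrow> a = 0) \<and>
      list_encode [q, a, digit b v i div 2, p, instr_code c] \<in> set_decode T"
    then show "\<exists>a. (snd (t ! i) \<longrightarrow> a = None) \<and> (q, a, fst (t ! i), p, c) \<in> trans_rel M"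
      using t lab lab0 by metis
  next
    assume "\<exists>a. (snd (t ! i) \<longrightarrow> a = None) \<and> (q, a, fst (t ! i), p, c) \<in> trans_rel M"
    then show "\<exists>a<N. (snd (t ! i) \<longrightarrow> a = 0) \<and>
      list_encode [q, a, digit b v i div 2, p, instr_code c] \<in> set_decode T"
      using t lab0 trans_bound(1) by metis
  qed
qed

lemma num_edge_iff:
  assumes "tape_digits b v t"
  shows "num_edge N S T b v (length t) (of_bool h) q i (of_bool h') p j \<longleftrightarrow>
    (\<exists>a. gedge M t a (h, q, i) (h', p, j))"
proof -
  have d: "digit b v i div 2 = stack_sym_code (fst (t ! i))" if "i < length t" for i
    using assms that by (auto simp: tape_digits_def)
  have top: "stack_sym_code x = 1 \<longleftrightarrow> x = Top" for x by (cases x) auto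
  have sym: "stack_sym_code x = y + 2 \<longleftrightarrow> x = Sym y" for x y by (cases x) auto
  let ?E = "\<lambda>c. \<exists>a. (snd (t ! i) \<longrightarrow> a = None) \<and> (q, a, fst (t ! i), p, c) \<in> trans_rel M"
  have s: "scan_trans N T b v q i p 0 \<longleftrightarrow> ?E Stay"
    "scan_trans N T b v q i p 2 \<longleftrightarrow> ?E Down"
    "scan_trans N T b v q i p 3 \<longleftrightarrow> ?E Here"
    "scan_trans N T b v q i p 4 \<longleftrightarrow> ?E Up"
    "\<And>y. scan_trans N T b v q i p (y + 5) \<longleftrightarrow> ?E (Push y)" if "i < length t"
    using scan_trans_iff[OF assms that, of q p] by (metis instr_code.simps)+
  have push: "y < N" if "?E (Push y)" for y using that trans_bound(2) by fastforce
  show ?thesis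
  proof (cases "i < length t")
    case True
    have "(\<exists>y<N. ?E (Push y) \<and> digit b v (Suc i) div 2 = y + 2) \<longleftrightarrow>
      (\<exists>y. ?E (Push y) \<and> fst (t ! Suc i) = Sym y)" if "Suc i < length t"
      unfolding d[OF that] sym using push by blast
    moreover have "digit b v (Suc i) div 2 = 1 \<longleftrightarrow> fst (t ! Suc i) = Top" if "Suc i < length t"
      unfolding d[OF that] top ..
    ultimately show ?thesis
      using True by (cases h; cases h') (auto simp: num_edge_def gedge.simps s[OF True])
  next
    case False
    then show ?thesis by (auto simp: num_edge_def gedge.simps)
  qed
qed

lemma node_code_eq [simp]: "node_code h q i = node_code h' q' i' \<longleftrightarrow> h = h' \<and> q = q' \<and> i = i'"
  by (simp add: node_code_def prod_encode_eq)

lemma num_accepts_iff: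
  assumes t: "tape_digits b v t" "t \<noteq> []" and F: "F \<subseteq> states M"
  shows "num_accepts N S T (start M) (set_encode F) b v (length t) \<longleftrightarrow> accepts_tape M F t"
proof -
  let ?l = "length t" and ?B = "Suc (node_code 1 N (length t))"
  let ?s = "(False, start M, 0)"
  let ?c = "\<lambda>(h, q, i). node_code (of_bool h) q i"
  have finF: "finite F" using F finite_components(1) by (rule finite_subset)
  have range: "q \<in> states M \<and> i < ?l" if "reach M t ?s (h, q, i)" for h q i
  proof (cases rule: rtranclp.cases[OF that])
    case 1
    then show ?thesis using sa t(2) by (auto simp: stack_automaton_def)
  next
    case (2 a b c)
    obtain h' q' i' where "b = (h', q', i')" by (cases b) auto
    then show ?thesis using 2 gedge_state[OF sa] gedge_bounded by fastforce
  qed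
  show ?thesis
  proof
    assume acc: "num_accepts N S T (start M) (set_encode F) b v ?l"
    \<comment> \<open>The codes of the reachable nodes form a closed set themselves, and this is the
      only instance of \<open>X\<close> that is needed here.\<close>
    let ?R = "?c ` {c. reach M t ?s c}"
    have sub: "?R \<subseteq> {..<?B}"
    proof
      fix x assume "x \<in> ?R"
      then obtain h q i where x: "x = node_code (of_bool h) q i" "reach M t ?s (h, q, i)" by auto
      have "q \<le> N" "i \<le> ?l" using range[OF x(2)] state_bound less_imp_le by blast+
      then have "x \<le> node_code 1 N ?l"
        unfolding x node_code_def by (intro prod_encode_mono) auto
      then show "x \<in> {..<?B}" by simp
    qed
    then have fin: "finite ?R" by (rule finite_subset) simp
    have X: "set_encode ?R < 2 ^ ?B" using sub by (rule set_encode_bound)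
    have mem: "node_code (of_bool h) q i \<in> set_decode (set_encode ?R) \<longleftrightarrow> reach M t ?s (h, q, i)" for h q i
    proof -
      have "inj ?c" by (auto simp: inj_def)
      from inj_image_mem_iff[OF this, of "(h, q, i)"] show ?thesis
        unfolding set_encode_inverse[OF fin] by simp
    qed
    have bool: "\<exists>x. h = of_bool x" if "h < 2" for h :: nat
      using that by (cases h) (auto intro: exI[of _ True] exI[of _ False])
    have init: "node_code 0 (start M) 0 \<in> set_decode (set_encode ?R)" using mem[of False] by simp
    have closed: "node_code h' p j \<in> set_decode (set_encode ?R)"
      if "h < 2" "h' < 2" and e: "num_edge N S T b v ?l h q i h' p j"
        and r: "node_code h q i \<in> set_decode (set_encode ?R)" for h q i h' p j
    proof -
      obtain x y where xy: "h = of_bool x" "h' = of_bool y" using \<open>h < 2\<close> \<open>h' < 2\<close> bool by metis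
      show ?thesis using e r unfolding xy num_edge_iff[OF t(1)] mem by (blast intro: reach_step)
    qed
    have "\<exists>q<N. \<exists>i<?l. q \<in> set_decode (set_encode F) \<and>
      node_code 1 q i \<in> set_decode (set_encode ?R)"
      by (rule acc[unfolded num_accepts_def, THEN spec, THEN mp, OF X, THEN mp],
          intro conjI allI impI, rule init, elim conjE, rule closed)
    then obtain q i where "q \<in> F" "node_code 1 q i \<in> set_decode (set_encode ?R)"
      using finF by auto
    then show "accepts_tape M F t" using mem[of True] unfolding accepts_tape_def by auto
  next
    assume "accepts_tape M F t"
    then obtain q i where qi: "q \<in> F" "reach M t ?s (True, q, i)"
      unfolding accepts_tape_def by blast
    show "num_accepts N S T (start M) (set_encode F) b v ?l"
      unfolding num_accepts_def
    proof (intro allI impI, elim conjE)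
      fix X assume s: "node_code 0 (start M) 0 \<in> set_decode X"
        and cl: "\<forall>h<2. \<forall>q<N. \<forall>i<?l. \<forall>h'<2. \<forall>p<N. \<forall>j<?l.
          num_edge N S T b v ?l h q i h' p j \<and> node_code h q i \<in> set_decode X \<longrightarrow>
          node_code h' p j \<in> set_decode X"
      have "?c c \<in> set_decode X" if "reach M t ?s c" for c using that
      proof (induction rule: rtranclp_induct)
        case base then show ?case using s by simp
      next
        case (step c d)
        obtain h q i where c: "c = (h, q, i)" by (cases c) auto
        obtain h' p j where d: "d = (h', p, j)" by (cases d) auto
        have "reach M t ?s d" using step.hyps by (rule rtranclp.rtrancl_into_rtrancl)
        then have "q < N" "i < ?l" "p < N" "j < ?l"
          using range step.hyps(1) c d state_bound by blast+
        moreover have "num_edge N S T b v ?l (of_bool h) q i (of_bool h') p j"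
          using step.hyps(2) c d num_edge_iff[OF t(1)] by blast
        moreover have "of_bool h < (2 :: nat)" "of_bool h' < (2 :: nat)" by auto
        moreover have "node_code (of_bool h) q i \<in> set_decode X" using step.IH c by simp
        ultimately show ?case using cl unfolding d prod.case by blast
      qed
      from this[OF qi(2)] have "node_code 1 q i \<in> set_decode X" by simp
      moreover have "q < N" "i < ?l" using range[OF qi(2)] state_bound by blast+
      ultimately show "\<exists>q<N. \<exists>i<?l. q \<in> set_decode (set_encode F) \<and> node_code 1 q i \<in> set_decode X"
        using qi(1) finF by auto
    qed
  qed
qed

lemma tape_digits_iff:
  "tape_digits b v (tape w) \<longleftrightarrow> digit b v 0 = 0 \<and> digit b v (Suc (length w)) = 2 \<and>
    (\<forall>i<length w. digit b v (Suc i) = 2 * (fst (w ! i) + 2) + of_bool (snd (w ! i)))"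
proof -
  have "tape w ! 0 = (Bottom, False)" "tape w ! Suc (length w) = (Top, False)"
    "\<And>i. i < length w \<Longrightarrow> tape w ! Suc i = (Sym (fst (w ! i)), snd (w ! i))"
    by (simp_all add: tape_def left_tape_def nth_append map_prod_def split_beta)
  moreover have "(\<forall>i<Suc (Suc m). P i) \<longleftrightarrow> P 0 \<and> P (Suc m) \<and> (\<forall>i<m. P (Suc i))"
    for P :: "nat \<Rightarrow> bool" and m
    using All_less_Suc2[of "Suc m" P] All_less_Suc[of m "\<lambda>i. P (Suc i)"] by blast
  ultimately show ?thesis unfolding tape_digits_def length_tape by simp
qed

lemma accepts_if_num_word:
  assumes nw: "num_word N S W T (start M) (set_encode F) v l" and F: "F \<subseteq> states M"
  obtains w where "accepts M F w" "l = length w + 2" "tape_digits (2 * N + 6) v (tape w)"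
proof -
  let ?d = "digit (2 * N + 6) v"
  let ?w = "map (\<lambda>i. (?d (Suc i) div 2 - 2, odd (?d (Suc i)))) [0..<l - 2]"
  have nt: "num_tape W (2 * N + 6) v l" using nw by (simp add: num_word_def)
  then have "2 \<le> l" by (simp add: num_tape_def)
  then have l: "l = length ?w + 2" by simp
  have half: "x = 2 * (x div 2 - 2 + 2) + of_bool (odd x)" if "2 \<le> x div 2" for x :: nat
    using that by (simp add: of_bool_def) presburger
  have td: "tape_digits (2 * N + 6) v (tape ?w)"
    unfolding tape_digits_iff
  proof (intro conjI allI impI)
    show "?d 0 = 0" using nt by (simp add: num_tape_def)
    have "Suc (length ?w) = l - 1" using \<open>2 \<le> l\<close> by simp
    then show "?d (Suc (length ?w)) = 2" using nt by (simp only: num_tape_def)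
    fix i assume i: "i < length ?w"
    then have wi: "?w ! i = (?d (Suc i) div 2 - 2, odd (?d (Suc i)))" by simp
    have "2 \<le> ?d (Suc i) div 2" using nt i by (simp add: num_tape_def)
    then show "?d (Suc i) = 2 * (fst (?w ! i) + 2) + of_bool (snd (?w ! i))"
      unfolding wi fst_conv snd_conv by (rule half)
  qed
  have "length (tape ?w) = l" using l by simp
  then have "accepts_tape M F (tape ?w)"
    using num_accepts_iff[OF td _ F] nw by (auto simp: num_word_def tape_def)
  moreover have "?w \<in> lists (work M \<times> UNIV)"
    using nt by (auto simp: marked_lists_iff num_tape_def)
  ultimately show ?thesis using that[of ?w] td l by (simp add: accepts_def)
qed

lemma num_word_if_accepts:
  assumes acc: "accepts M F w" and F: "F \<subseteq> states M"
  obtains v where "v < (2 * N + 6) ^ (length w + 2)"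
    "num_word N S W T (start M) (set_encode F) v (length w + 2)"
    "tape_digits (2 * N + 6) v (tape w)"
proof -
  let ?t = "tape w" and ?b = "2 * N + 6"
  let ?f = "\<lambda>i. 2 * stack_sym_code (fst (?t ! i)) + of_bool (snd (?t ! i))"
  have w: "fst (w ! i) \<in> work M" if "i < length w" for i
  proof -
    have "set (map fst w) \<subseteq> work M" using acc by (simp add: accepts_def marked_lists_iff)
    then show ?thesis using nth_mem[of i "map fst w"] that by auto
  qed
  have "?f i < ?b" if "i < length ?t" for i
  proof -
    have "?t ! i \<in> set ?t" using that by (rule nth_mem)
    moreover have "2 * stack_sym_code (fst x) + of_bool (snd x) < ?b" if "x \<in> set ?t" for x
    proof -
      have "fst x = Bottom \<or> fst x = Top \<or> (\<exists>y \<in> work M. fst x = Sym y)"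
        using that acc by (auto simp: tape_def left_tape_def accepts_def lists_eq_set)
      moreover have "of_bool (snd x) \<le> (1 :: nat)" by simp
      ultimately show ?thesis using work_bound by fastforce
    qed
    ultimately show ?thesis by blast
  qed
  then obtain v where v: "v < ?b ^ length ?t" "\<forall>i<length ?t. digit ?b v i = ?f i"
    using digits_exist[of "length ?t" ?f ?b] by blast
  then have td: "tape_digits ?b v ?t" by (simp add: tape_digits_def)
  then have "num_tape W ?b v (length w + 2)"
    using w unfolding tape_digits_iff num_tape_def by auto
  moreover have "num_accepts N S T (start M) (set_encode F) ?b v (length w + 2)"
    using num_accepts_iff[OF td _ F] acc by (simp add: accepts_def tape_def)
  ultimately show ?thesis using that[of v] v(1) td by (simp add: num_word_def)
qed

lemma target_subset: "target_states z M \<subseteq> states M"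
  using sa by (cases z) (auto simp: stack_automaton_def)

lemma target_code:
  "set_encode (target_states z M) = (if z = Accept then set_encode (final M) else S)"
  by (cases z) auto

text \<open>The names of states and symbols are below the code, so the code bounds how many there
  are; nothing has to be counted by the decision procedure.\<close>

lemma csa_bounds: "csa M N"
proof
  have "states M \<subseteq> {..<N}" "work M \<subseteq> {..<N}" using state_bound work_bound by auto
  from card_mono[OF _ this(1)] card_mono[OF _ this(2)]
  show "card (states M) \<le> N" "card (work M) \<le> N" by simp_all
qed (rule csa)

text \<open>Injectivity of \<open>list_encode\<close> leaves only the true components to be found,
  and they lie within the search bounds.\<close>

lemma decode_sa_code:
  "(\<exists>S'<N. \<exists>I<N. \<exists>W'<N. \<exists>T'<N. \<exists>q<N. \<exists>F<N. N = list_encode [S', I, W', T', q, F] \<and> P S' W' T' q F)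
    \<longleftrightarrow> P S W T (start M) (set_encode (final M))" (is "?L \<longleftrightarrow> ?R")
proof
  assume ?L
  then obtain S' I W' T' q F where *: "N = list_encode [S', I, W', T', q, F]" "P S' W' T' q F" by blast
  from *(1) have "[S', I, W', T', q, F] =
    [S, set_encode (inputs M), W, T, start M, set_encode (final M)]"
    unfolding sa_code_def list_encode_eq by (rule sym)
  then show ?R using *(2) by simp
next
  have "N = list_encode [S, set_encode (inputs M), W, T, start M, set_encode (final M)]"
    by (rule sa_code_def)
  then show "?R \<Longrightarrow> ?L" using code_components by blast
qed

lemma code_quiet_block_iff:
  "code_quiet_block z N \<longleftrightarrow> quiet_block M (target_states z M) (class_bound N)"
proof -
  let ?K = "class_bound N" and ?F = "set_encode (target_states z M)" and ?b = "2 * N + 6"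
  have "code_quiet_block z N \<longleftrightarrow>
    (\<exists>l<3 * ?K + 3. \<exists>v<?b ^ l. num_word N S W T (start M) ?F v l \<and>
      (\<exists>s<l. \<forall>i<?K. s + i < l \<and> odd (digit ?b v (s + i))))" (is "_ \<longleftrightarrow> ?L")
    unfolding code_quiet_block_def target_code by (rule decode_sa_code)
  also have "\<dots> \<longleftrightarrow> quiet_block M (target_states z M) ?K"
    unfolding csa.quiet_block_iff_short[OF csa_bounds]
  proof
    assume ?L
    then obtain l v s where *: "l < 3 * ?K + 3" "num_word N S W T (start M) ?F v l"
      "\<forall>i<?K. s + i < l \<and> odd (digit ?b v (s + i))" by blast
    obtain w where w: "accepts M (target_states z M) w" "l = length w + 2" "tape_digits ?b v (tape w)"
      using accepts_if_num_word[OF *(2) target_subset] .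
    have q: "0 < s + i \<and> s + i \<le> length w \<and> snd (w ! (s + i - 1))" if "i < ?K" for i
    proof -
      have "s + i < length (tape w)" "odd (digit ?b v (s + i))" using *(3) that w(2) by auto
      then have "snd (tape w ! (s + i))" using w(3) by (auto simp: tape_digits_def)
      then show ?thesis using \<open>s + i < length (tape w)\<close> snd_tape[of "s + i" w] by simp
    qed
    \<comment> \<open>Marker digits are even, so the block avoids both ends. Tape positions exceed
      word positions by one, hence \<open>s - 1\<close> is its start in \<open>w\<close>.\<close>
    have s: "0 < s" using q[of 0] class_bound_pos by simp
    have "s - 1 + ?K \<le> length w" using q[of "?K - 1"] class_bound_pos[of N] s by simp
    moreover have "snd (w ! (s - 1 + i))" if "i < ?K" for i using q[OF that] s by simp
    moreover have "length w \<le> 3 * ?K" using *(1) w(2) by simp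
    ultimately show "\<exists>w. accepts M (target_states z M) w \<and> length w \<le> 3 * ?K \<and>
      (\<exists>s. s + ?K \<le> length w \<and> (\<forall>i<?K. snd (w ! (s + i))))" using w(1) by blast
  next
    assume "\<exists>w. accepts M (target_states z M) w \<and> length w \<le> 3 * ?K \<and>
      (\<exists>s. s + ?K \<le> length w \<and> (\<forall>i<?K. snd (w ! (s + i))))"
    then obtain w s where w: "accepts M (target_states z M) w" "length w \<le> 3 * ?K"
      "s + ?K \<le> length w" "\<forall>i<?K. snd (w ! (s + i))" by blast
    obtain v where v: "v < ?b ^ (length w + 2)" "num_word N S W T (start M) ?F v (length w + 2)"
      "tape_digits ?b v (tape w)" using num_word_if_accepts[OF w(1) target_subset] .
    have "Suc s + i < length w + 2 \<and> odd (digit ?b v (Suc s + i))" if "i < ?K" for i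
      using v(3) w(3,4) that by (auto simp: tape_digits_iff)
    moreover have "Suc s < length w + 2" "length w + 2 < 3 * ?K + 3" using w(2,3) by auto
    ultimately show ?L using v(1,2) by blast
  qed
  finally show ?thesis .
qed

lemma code_long_word_iff:
  "code_long_word z N \<longleftrightarrow> long_word M (target_states z M) (class_bound N)"
proof -
  let ?K = "class_bound N" and ?F = "set_encode (target_states z M)" and ?b = "2 * N + 6"
  have "code_long_word z N \<longleftrightarrow>
    (\<exists>l<2 * ?K + 3. \<exists>v<?b ^ l. num_word N S W T (start M) ?F v l \<and> ?K + 2 \<le> l)" (is "_ \<longleftrightarrow> ?L")
    unfolding code_long_word_def target_code by (rule decode_sa_code)
  also have "\<dots> \<longleftrightarrow> long_word M (target_states z M) ?K"
    unfolding csa.long_word_iff_short[OF csa_bounds]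
  proof
    assume ?L
    then obtain l v where *: "l < 2 * ?K + 3" "num_word N S W T (start M) ?F v l" "?K + 2 \<le> l"
      by blast
    obtain w where "accepts M (target_states z M) w" "l = length w + 2"
      using accepts_if_num_word[OF *(2) target_subset] .
    then show "\<exists>w. accepts M (target_states z M) w \<and> ?K \<le> length w \<and> length w \<le> 2 * ?K"
      using * by auto
  next
    assume "\<exists>w. accepts M (target_states z M) w \<and> ?K \<le> length w \<and> length w \<le> 2 * ?K"
    then obtain w where w: "accepts M (target_states z M) w" "?K \<le> length w" "length w \<le> 2 * ?K"
      by blast
    obtain v where "v < ?b ^ (length w + 2)" "num_word N S W T (start M) ?F v (length w + 2)"
      using num_word_if_accepts[OF w(1) target_subset] .
    moreover have "length w + 2 < 2 * ?K + 3" "?K + 2 \<le> length w + 2" using w by auto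
    ultimately show ?L by blast
  qed
  finally show ?thesis .
qed

end

section \<open>The decision function and the theorem\<close>

text \<open>The order of the tests matters: a quiet block of the critical length also yields a long
  word, so the second test separates the cases only after the first has failed.\<close>

definition space_class :: "space_kind \<Rightarrow> nat \<Rightarrow> nat" where
  "space_class z c = (if code_quiet_block z c then 1 else if code_long_word z c then 3 else 2)"

lemma computable_space_class: "computable (space_class z)"
  unfolding space_class_def[abs_def]
  by (intro computable_if_recfun recfun_if recfun_const recpred_code_quiet_block recpred_code_long_word)

theorem corollary19:
  "(\<forall>(M :: ('q, 'a, 'g) sa) z. checking_stack_automaton M \<longrightarrow>
      (unlimited z M \<or> constant_space z M \<or> linear_space z M) \<and>
      \<not> (unlimited z M \<and> constant_space z M) \<and>
      \<not> (unlimited z M \<and> linear_space z M) \<and>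
      \<not> (constant_space z M \<and> linear_space z M)) \<and>
   (\<forall>z. \<exists>f. computable f \<and>
      (\<forall>M :: (nat, nat, nat) sa. checking_stack_automaton M \<longrightarrow>
         (f (sa_code M) = 1 \<longleftrightarrow> unlimited z M) \<and>
         (f (sa_code M) = 2 \<longleftrightarrow> constant_space z M) \<and>
         (f (sa_code M) = 3 \<longleftrightarrow> linear_space z M)))"
proof (intro conjI allI impI exI)
  fix M :: "('q, 'a, 'g) sa" and z assume "checking_stack_automaton M"
  then interpret csa M z "max (card (states M)) (card (work M))" by unfold_locales auto
  show "unlimited z M \<or> constant_space z M \<or> linear_space z M"
    unfolding unlimited_iff constant_iff linear_iff by blast
  show "\<not> (unlimited z M \<and> constant_space z M)" by (simp add: constant_space_def)
  show "\<not> (unlimited z M \<and> linear_space z M)" by (simp add: linear_space_def)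
  show "\<not> (constant_space z M \<and> linear_space z M)" by (rule constant_linear_exclusive)
next
  fix z show "computable (space_class z)" by (rule computable_space_class)
next
  fix z and M :: "(nat, nat, nat) sa" assume "checking_stack_automaton M"
  then interpret coded_csa M by unfold_locales
  \<comment> \<open>With the code as bound, \<open>K\<close> is exactly the class bound that
    \<open>space_class\<close> tests.\<close>
  interpret csa M z N by (rule csa_bounds)
  have "quiet_block M (target_states z M) K \<Longrightarrow> long_word M (target_states z M) K"
    by (rule long_word_if_quiet_block)
  then show "space_class z (sa_code M) = 1 \<longleftrightarrow> unlimited z M"
    "space_class z (sa_code M) = 2 \<longleftrightarrow> constant_space z M"
    "space_class z (sa_code M) = 3 \<longleftrightarrow> linear_space z M"
    unfolding unlimited_iff constant_iff linear_iff space_class_def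
      code_quiet_block_iff code_long_word_iff by auto
qed

end
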